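(* Let $p$ and $q$ be prime numbers with $q=p+2$ and $p\equiv3\pmod 8$, and let $E$ be the elliptic curve $y^2=x(x+p)(x+q)$ over $\mathbf{Q}$. Suppose there are integers $a,b,c$ and $\varepsilon,\delta\in\{+1,-1\}$ with $q=a^2+b^2$ and $(a+\varepsilon)^2+(b+\delta)^2=c^2$. Then $\operatorname{rank}E(\mathbf{Q})=1$. *)

theory Defs
  imports
    "HOL-Algebra.FiniteProduct"
    "HOL-Computational_Algebra.Polynomial"
    "HOL-Computational_Algebra.Primes"
    "HOL-Library.Extended_Nat"
begin

text \<open>
  Points of the curve \<open>y\<^sup>2 = f(x)\<close> with coordinates in the field \<open>'a\<close>, including the point at
  infinity. Here \<open>f\<close> is meant to be a monic cubic with no repeated roots in an algebraic closure
  and \<open>'a\<close> a field of characteristic other than 2; these are then exactly the \<open>'a\<close>-rational points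
  of an elliptic curve.
\<close>

datatype 'a point = Infinity | Affine 'a 'a

definition ec_points :: "'a::field poly \<Rightarrow> 'a point set" where
  "ec_points f = insert Infinity {Affine x y | x y. y\<^sup>2 = poly f x}"

text \<open>
  The chord-tangent law: if the line through the two points has slope \<open>l\<close>, then the \<open>x\<close>-coordinates
  of its three intersections with the curve are the roots of \<open>f(x) - (l x + m)\<^sup>2\<close>, so (\<open>f\<close> being
  monic) they add up to \<open>l\<^sup>2 - coeff f 2\<close>. The third intersection is reflected in the \<open>x\<close>-axis.
\<close>

fun ec_add :: "'a::field poly \<Rightarrow> 'a point \<Rightarrow> 'a point \<Rightarrow> 'a point" where
  "ec_add f Infinity Q = Q"
| "ec_add f P Infinity = P"
| "ec_add f (Affine x1 y1) (Affine x2 y2) =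
    (if x1 = x2 \<and> y1 = - y2 then Infinity
     else
       let l = (if x1 = x2 then poly (pderiv f) x1 / (2 * y1) else (y2 - y1) / (x2 - x1));
           x3 = l\<^sup>2 - coeff f 2 - x1 - x2
       in Affine x3 (l * (x1 - x3) - y1))"

definition ec_group :: "'a::field poly \<Rightarrow> 'a point monoid" where
  "ec_group f = \<lparr>carrier = ec_points f, monoid.mult = ec_add f, one = Infinity\<rparr>"

text \<open>
  The rank of an abelian group: the largest size of a \<open>\<int>\<close>-linearly independent set (equivalently the
  dimension of its tensor product with the rationals). For a finitely generated group this is the
  \<open>r\<close> in the decomposition into the torsion subgroup and \<open>\<int>\<^sup>r\<close>. The group is written
  multiplicatively, so integer multiples are powers.
\<close>

definition int_independent :: "('a, 'b) monoid_scheme \<Rightarrow> 'a set \<Rightarrow> bool" where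
  "int_independent G S \<longleftrightarrow>
    (\<forall>n :: 'a \<Rightarrow> int. finprod G (\<lambda>x. x [^]\<^bsub>G\<^esub> n x) S = \<one>\<^bsub>G\<^esub> \<longrightarrow> (\<forall>x\<in>S. n x = 0))"

definition abelian_rank :: "('a, 'b) monoid_scheme \<Rightarrow> enat" where
  "abelian_rank G =
    (SUP S \<in> {S. S \<subseteq> carrier G \<and> finite S \<and> int_independent G S}. enat (card S))"

end

theory Submission
  imports
    Defs
    "HOL-Number_Theory.Cong"
    "HOL-Computational_Algebra.Squarefree"
begin

text \<open>
  Replacing \<open>(a, b)\<close> by \<open>(\<epsilon>a, \<delta>b)\<close>, put \<open>\<alpha> = q + a + b\<close>, \<open>\<beta> = a + b + 2\<close>, \<open>\<gamma> = a - b\<close>. Then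
  \<open>\<alpha>\<^sup>2 - \<beta>\<^sup>2 = p c\<^sup>2\<close> and \<open>\<alpha>\<^sup>2 + \<gamma>\<^sup>2 = q c\<^sup>2\<close>, so \<open>G = (-\<alpha>\<^sup>2/c\<^sup>2, \<alpha>\<beta>\<gamma>/c\<^sup>3)\<close> is a rational point.
  Complete 2-descent, using that 2 is a non-residue modulo \<open>p\<close> and \<open>q\<close> while \<open>-1\<close> is a residue modulo
  \<open>q\<close>, shows that the classes of \<open>G\<close> and of the 2-torsion generate \<open>E(\<rat>)/2E(\<rat>)\<close>. As the
  classes of \<open>G + T\<close> and \<open>T \<noteq> O\<close> are nontrivial for \<open>T\<close> in the 2-torsion, \<open>G\<close> has infinite order.
  Conversely, write a given point as \<open>P = m + 2R\<close>, where \<open>2m\<close> is a multiple of \<open>G\<close>, and repeat with \<open>R\<close>.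
  The heights stay bounded, so the sequence becomes periodic; thus \<open>X = m' + 2\<^sup>k X\<close> for some
  \<open>X\<close> in it, and a nonzero multiple of \<open>P\<close> is a multiple of \<open>G\<close>.
\<close>

section \<open>The group law\<close>

text \<open>The corrections made in the descent mix 2-torsion with \<open>gen\<close>. They are
  collected in \<open>half_multiples\<close>, the points whose double is a multiple of
  \<open>gen\<close>: a subgroup that absorbs both, and a final doubling removes the torsion again.
  The classes of \<open>x\<close> and \<open>x + q\<close> modulo squares a priori form 8 * 4 = 32
  pairs (\<open>x\<close> in the span of -1, p, q; \<open>x + q\<close> positive, in the span of 2,
  q). Divisibility by q leaves 16 pairs, and four residue arguments leave 8: the classes of the four
  2-torsion points, each with both signs on \<open>x\<close>. The sign is what torsion cannot
  supply; as \<open>gx\<close> is minus a square and \<open>gx + q\<close> is a square,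
  \<open>gen\<close> supplies exactly it. For the heights only exponents matter: up to constants,
  doubling raises the height to at least its fourth power, while adding one of at most eight fixed
  points at most squares it. One step therefore gives h(R)^2 <= C h(P), so a height bound that is at
  least C persists along the whole sequence.\<close>

locale elliptic_curve =
  fixes a2 a4 a6 :: "'a::field"
  assumes two_nonzero: "(2::'a) \<noteq> 0"
    and nonsingular: "x^3 + a2 * x\<^sup>2 + a4 * x + a6 = 0 \<Longrightarrow> 3 * x\<^sup>2 + 2 * a2 * x + a4 \<noteq> 0"
begin

definition cubic :: "'a poly" where
  "cubic = [:a6, a4, a2, 1:]"

lemma poly_cubic: "poly cubic x = x^3 + a2 * x\<^sup>2 + a4 * x + a6"
  by (simp add: cubic_def algebra_simps power2_eq_square power3_eq_cube)

lemma poly_pderiv_cubic: "poly (pderiv cubic) x = 3 * x\<^sup>2 + 2 * a2 * x + a4"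
  by (simp add: cubic_def pderiv_pCons algebra_simps power2_eq_square)

lemma coeff_cubic_2 [simp]: "coeff cubic 2 = a2"
  by (simp add: cubic_def numeral_2_eq_2)

definition on_curve :: "'a \<Rightarrow> 'a \<Rightarrow> bool" where
  "on_curve x y \<longleftrightarrow> y\<^sup>2 = x^3 + a2 * x\<^sup>2 + a4 * x + a6"

lemma Affine_in_points [simp]: "Affine x y \<in> ec_points cubic \<longleftrightarrow> on_curve x y"
  by (auto simp: ec_points_def on_curve_def poly_cubic)

lemma Infinity_in_points [simp]: "Infinity \<in> ec_points cubic"
  by (auto simp: ec_points_def)

text \<open>The second equation is the chord condition after division of the difference of the two
  curve equations by \<open>x1 - x2\<close>. For equal points it becomes the tangent condition, so
  chords and tangents obey one pair of polynomial equations.\<close>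

definition is_slope :: "'a \<Rightarrow> 'a \<Rightarrow> 'a \<Rightarrow> 'a \<Rightarrow> 'a \<Rightarrow> bool" where
  "is_slope l x1 y1 x2 y2 \<longleftrightarrow> y1 - y2 = l * (x1 - x2) \<and>
     l * (y1 + y2) = x1\<^sup>2 + x1 * x2 + x2\<^sup>2 + a2 * (x1 + x2) + a4"

lemma is_slope_exists:
  assumes "on_curve x1 y1" "on_curve x2 y2" "\<not> (x1 = x2 \<and> y1 = - y2)"
  shows "\<exists>l. is_slope l x1 y1 x2 y2"
proof (cases "x1 = x2")
  case True
  then have "(y1 - y2) * (y1 + y2) = 0"
    using assms(1,2) unfolding on_curve_def by (simp add: algebra_simps power2_eq_square)
  with True assms(3) have "y1 = y2" by (auto simp: add_eq_0_iff2)
  with assms(3) True have "y1 + y1 \<noteq> 0"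
    by (auto simp: eq_neg_iff_add_eq_0)
  then show ?thesis using True \<open>y1 = y2\<close>
    unfolding is_slope_def
    by (intro exI[of _ "(x1\<^sup>2 + x1 * x2 + x2\<^sup>2 + a2 * (x1 + x2) + a4) / (y1 + y2)"]) simp
next
  case False
  define l where "l = (y1 - y2) / (x1 - x2)"
  have l: "y1 - y2 = l * (x1 - x2)" using False by (simp add: l_def)
  have "(x1 - x2) * (l * (y1 + y2)) = (y1 - y2) * (y1 + y2)" using l by simp
  also have "\<dots> = (x1 - x2) * (x1\<^sup>2 + x1 * x2 + x2\<^sup>2 + a2 * (x1 + x2) + a4)"
    using assms(1,2) unfolding on_curve_def by algebra
  finally have "l * (y1 + y2) = x1\<^sup>2 + x1 * x2 + x2\<^sup>2 + a2 * (x1 + x2) + a4"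
    using False by simp
  then show ?thesis using l unfolding is_slope_def by blast
qed

text \<open>For opposite points the first slope equation would give y = 0 and the second a vanishing
  derivative of the cubic, that is, a singular point.\<close>

lemma is_slope_not_opposite:
  assumes "on_curve x1 y1" "is_slope l x1 y1 x2 y2"
  shows "\<not> (x1 = x2 \<and> y1 = - y2)"
proof
  assume eq: "x1 = x2 \<and> y1 = - y2"
  then have "2 * y2 = 0" using assms(2) unfolding is_slope_def by simp
  then have y: "y2 = 0" using two_nonzero by simp
  then have "x1^3 + a2 * x1\<^sup>2 + a4 * x1 + a6 = 0" using assms(1) eq unfolding on_curve_def by simp
  moreover have "3 * x1\<^sup>2 + 2 * a2 * x1 + a4 = 0"
    using assms(2) y eq unfolding is_slope_def by (simp add: algebra_simps power2_eq_square)
  ultimately show False using nonsingular by blast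
qed

lemma ec_add_eq:
  assumes "on_curve x1 y1" "on_curve x2 y2" "is_slope l x1 y1 x2 y2"
  shows "ec_add cubic (Affine x1 y1) (Affine x2 y2) =
    Affine (l\<^sup>2 - a2 - x1 - x2) (l * (x1 - (l\<^sup>2 - a2 - x1 - x2)) - y1)"
proof -
  have no: "\<not> (x1 = x2 \<and> y1 = - y2)" using is_slope_not_opposite assms by blast
  have "(if x1 = x2 then poly (pderiv cubic) x1 / (2 * y1) else (y2 - y1) / (x2 - x1)) = l"
  proof (cases "x1 = x2")
    case True
    then have "y1 = y2" using assms(3) unfolding is_slope_def by simp
    then have "2 * y1 \<noteq> 0" using True no two_nonzero
      by (metis add.inverse_neutral mult_eq_0_iff)
    moreover have "l * (2 * y1) = poly (pderiv cubic) x1"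
      using assms(3) True \<open>y1 = y2\<close> unfolding is_slope_def poly_pderiv_cubic
      by (simp add: algebra_simps power2_eq_square)
    ultimately show ?thesis using True by (simp add: field_simps)
  next
    case False
    have "y2 - y1 = l * (x2 - x1)" using assms(3) unfolding is_slope_def by algebra
    then show ?thesis using False by simp
  qed
  then show ?thesis using no by (simp add: Let_def)
qed

lemma third_point_on_curve:
  assumes "on_curve x1 y1" "is_slope l x1 y1 x2 y2"
  shows "on_curve (l\<^sup>2 - a2 - x1 - x2) (l * (x1 - (l\<^sup>2 - a2 - x1 - x2)) - y1)"
  using assms unfolding on_curve_def is_slope_def by algebra

lemma is_slope_third_point:
  assumes "on_curve x1 y1" "is_slope l x1 y1 x2 y2"
  shows "is_slope l x1 y1 (l\<^sup>2 - a2 - x1 - x2) (y1 - l * (x1 - (l\<^sup>2 - a2 - x1 - x2)))"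
  using assms unfolding on_curve_def is_slope_def by algebra

lemma is_slope_sym: "is_slope l x1 y1 x2 y2 \<Longrightarrow> is_slope l x2 y2 x1 y1"
  unfolding is_slope_def by (simp add: algebra_simps)

lemma is_slope_neg: "is_slope l x1 y1 x2 y2 \<Longrightarrow> is_slope (- l) x1 (- y1) x2 (- y2)"
  unfolding is_slope_def by (simp add: algebra_simps)

text \<open>The slope \<open>s\<close> is used only through \<open>(s + l) * k = x1 - x3\<close>.
  Multiplied by \<open>k\<close> and by \<open>k * k\<close> respectively, the two slope equations
  become polynomial consequences of the hypotheses; \<open>k\<close> is cancelled
  afterwards.\<close>

lemma is_slope_assoc:
  assumes l: "is_slope l x1 y1 x2 y2" and m: "is_slope m x2 y2 x3 y3"
    and k: "k = l - m" "k \<noteq> 0" and u: "u = l\<^sup>2 - a2 - x1 - x2"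
  shows "is_slope (- l - (x3 - x1) / k) u (l * (x1 - u) - y1) x3 y3"
proof -
  define s where "s = - l - (x3 - x1) / k"
  have s: "(s + l) * k = x1 - x3" using k(2) by (simp add: s_def field_simps)
  have "k * ((l * (x1 - u) - y1) - y3 - s * (u - x3)) = 0"
    using s l m u k(1) unfolding is_slope_def by algebra
  then have 1: "(l * (x1 - u) - y1) - y3 = s * (u - x3)" using k(2) by simp
  have "k * k * (s * ((l * (x1 - u) - y1) + y3) - (u\<^sup>2 + u * x3 + x3\<^sup>2 + a2 * (u + x3) + a4)) = 0"
    using s l m u k(1) unfolding is_slope_def by algebra
  then have "s * ((l * (x1 - u) - y1) + y3) = u\<^sup>2 + u * x3 + x3\<^sup>2 + a2 * (u + x3) + a4"
    using k(2) by simp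
  with 1 show ?thesis unfolding is_slope_def s_def by blast
qed


section \<open>Inverses, closure, commutativity and associativity\<close>

fun ec_neg :: "'a point \<Rightarrow> 'a point" where
  "ec_neg Infinity = Infinity"
| "ec_neg (Affine x y) = Affine x (- y)"

lemma on_curve_neg [simp]: "on_curve x (- y) \<longleftrightarrow> on_curve x y"
  by (simp add: on_curve_def)

lemma ec_neg_closed: "P \<in> ec_points cubic \<Longrightarrow> ec_neg P \<in> ec_points cubic"
  by (cases P) auto

lemma ec_neg_neg [simp]: "ec_neg (ec_neg P) = P"
  by (cases P) auto

lemma ec_add_neg [simp]: "ec_add cubic (ec_neg P) P = Infinity"
  by (cases P) auto

lemma ec_add_neg_right [simp]: "ec_add cubic P (ec_neg P) = Infinity"
  by (cases P) auto

lemma ec_add_Infinity_right [simp]: "ec_add cubic P Infinity = P"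
  by (cases P) auto

lemma ec_sum_cases:
  assumes "P \<in> ec_points cubic" "Q \<in> ec_points cubic"
  obtains "P = Infinity" | "Q = Infinity" | "P = ec_neg Q"
  | x1 y1 x2 y2 l where "P = Affine x1 y1" "Q = Affine x2 y2" "on_curve x1 y1" "on_curve x2 y2"
    "is_slope l x1 y1 x2 y2"
proof (cases P; cases Q)
  fix x1 y1 x2 y2 assume PQ: "P = Affine x1 y1" "Q = Affine x2 y2"
  show thesis
  proof (cases "x1 = x2 \<and> y1 = - y2")
    case True then show thesis using that(3) PQ by simp
  next
    case False then show thesis using that(4) PQ assms is_slope_exists[of x1 y1 x2 y2] by auto
  qed
qed (use that in auto)

lemma ec_add_closed:
  assumes "P \<in> ec_points cubic" "Q \<in> ec_points cubic"
  shows "ec_add cubic P Q \<in> ec_points cubic"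
  by (rule ec_sum_cases[OF assms])
     (use assms ec_add_eq third_point_on_curve in auto)

lemma ec_add_comm:
  assumes "P \<in> ec_points cubic" "Q \<in> ec_points cubic"
  shows "ec_add cubic P Q = ec_add cubic Q P"
proof (rule ec_sum_cases[OF assms])
  fix x1 y1 x2 y2 l assume *: "P = Affine x1 y1" "Q = Affine x2 y2" "on_curve x1 y1" "on_curve x2 y2"
    "is_slope l x1 y1 x2 y2"
  have "y1 - y2 = l * (x1 - x2)" using *(5) unfolding is_slope_def by simp
  then show ?thesis
    using * ec_add_eq[of x1 y1 x2 y2 l] ec_add_eq[of x2 y2 x1 y1 l] is_slope_sym[OF *(5)]
    by (simp add: algebra_simps)
qed auto

text \<open>The line through -P and P + Q is the mirror image of the line PQ, so its third point is
  -Q. This also settles the degenerate cases of associativity in which two neighbouring points are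
  opposite.\<close>

lemma ec_add_cancel_left:
  assumes "P \<in> ec_points cubic" "Q \<in> ec_points cubic"
  shows "ec_add cubic (ec_neg P) (ec_add cubic P Q) = Q"
proof (rule ec_sum_cases[OF assms])
  fix x1 y1 x2 y2 l assume *: "P = Affine x1 y1" "Q = Affine x2 y2" "on_curve x1 y1" "on_curve x2 y2"
    "is_slope l x1 y1 x2 y2"
  define x3 where "x3 = l\<^sup>2 - a2 - x1 - x2"
  have y: "y1 - y2 = l * (x1 - x2)" using *(5) unfolding is_slope_def by simp
  have c: "on_curve x3 (l * (x1 - x3) - y1)" using third_point_on_curve[OF *(3,5)] by (simp add: x3_def)
  have "is_slope l x1 y1 x3 (y1 - l * (x1 - x3))"
    using is_slope_third_point[OF *(3,5)] by (simp add: x3_def)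
  then have "is_slope (- l) x1 (- y1) x3 (l * (x1 - x3) - y1)"
    using is_slope_neg by fastforce
  then have "ec_add cubic (Affine x1 (- y1)) (Affine x3 (l * (x1 - x3) - y1)) =
      Affine (l\<^sup>2 - a2 - x1 - x3) (- l * (x1 - (l\<^sup>2 - a2 - x1 - x3)) + y1)"
    using ec_add_eq[of x1 "- y1" x3 "l * (x1 - x3) - y1" "- l"] *(3) c by simp
  moreover have "l\<^sup>2 - a2 - x1 - x3 = x2" by (simp add: x3_def)
  moreover have "- l * (x1 - x2) + y1 = y2" using y by (simp add: algebra_simps)
  ultimately show ?thesis using * ec_add_eq[of x1 y1 x2 y2 l] by (simp add: x3_def)
qed (use assms ec_neg_closed in auto)

text \<open>
  Let \<open>l\<close> and \<open>m\<close> be the slopes of the lines \<open>PQ\<close> and \<open>QR\<close> (chords or tangents). If \<open>l \<noteq> m\<close>, then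
  \<open>- l - (x3 - x1) / (l - m)\<close> is the slope of the line through \<open>P + Q\<close> and \<open>R\<close>, and
  \<open>- m - (x3 - x1) / (l - m)\<close> that of the line through \<open>P\<close> and \<open>Q + R\<close>; with these values both
  triple sums are given by the same formula. If \<open>l = m\<close>, the three points are collinear.
\<close>
lemma ec_add_assoc_affine:
  assumes c: "on_curve x1 y1" "on_curve x2 y2" "on_curve x3 y3"
    and l: "is_slope l x1 y1 x2 y2" and m: "is_slope m x2 y2 x3 y3"
  shows "ec_add cubic (ec_add cubic (Affine x1 y1) (Affine x2 y2)) (Affine x3 y3) =
    ec_add cubic (Affine x1 y1) (ec_add cubic (Affine x2 y2) (Affine x3 y3))"
proof -
  define u where "u = l\<^sup>2 - a2 - x1 - x2"
  define v where "v = m\<^sup>2 - a2 - x3 - x2"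
  define yu where "yu = l * (x1 - u) - y1"
  define yv where "yv = m * (x3 - v) - y3"
  have y12: "y1 - y2 = l * (x1 - x2)" using l unfolding is_slope_def by simp
  have y32: "y3 - y2 = m * (x3 - x2)" using is_slope_sym[OF m] unfolding is_slope_def by simp
  have PQ: "ec_add cubic (Affine x1 y1) (Affine x2 y2) = Affine u yu"
    using ec_add_eq[OF c(1,2) l] by (simp add: u_def yu_def)
  have "ec_add cubic (Affine x3 y3) (Affine x2 y2) = Affine v yv"
    using ec_add_eq[OF c(3,2) is_slope_sym[OF m]] by (simp add: v_def yv_def)
  then have QR: "ec_add cubic (Affine x2 y2) (Affine x3 y3) = Affine v yv"
    using ec_add_comm[of "Affine x2 y2" "Affine x3 y3"] c by simp
  have cu: "on_curve u yu" using third_point_on_curve[OF c(1) l] by (simp add: u_def yu_def)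
  have cv: "on_curve v yv" using third_point_on_curve[OF c(3) is_slope_sym[OF m]]
    by (simp add: v_def yv_def)
  have lm: "x1\<^sup>2 + x1 * x2 + a2 * x1 - l * (y1 + y2) = x2 * x3 + x3\<^sup>2 + a2 * x3 - m * (y2 + y3)"
    using l m unfolding is_slope_def by (simp add: algebra_simps)
  show ?thesis
  proof (cases "l = m")
    case False
    define k where "k = l - m"
    have k: "k \<noteq> 0" using False by (simp add: k_def)
    define s where "s = - l - (x3 - x1) / k"
    define t where "t = - m - (x3 - x1) / k"
    have s: "is_slope s u yu x3 y3"
      using is_slope_assoc[OF l m k_def k u_def] by (simp add: s_def yu_def)
    have "is_slope (- m - (x1 - x3) / - k) v (m * (x3 - v) - y3) x1 y1"
      by (rule is_slope_assoc[OF is_slope_sym[OF m] is_slope_sym[OF l]])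
         (use k in \<open>auto simp: k_def v_def\<close>)
    then have t: "is_slope t x1 y1 v yv"
      using is_slope_sym k by (simp add: t_def yv_def diff_divide_distrib)
    have st: "(s + l) * k = x1 - x3" using k unfolding s_def by simp
    have ts: "t - s = k" by (simp add: s_def t_def k_def)
    have x: "s\<^sup>2 - a2 - u - x3 = t\<^sup>2 - a2 - x1 - v"
      using st ts k_def u_def v_def by algebra
    have y: "s * (u - (s\<^sup>2 - a2 - u - x3)) - yu = t * (x1 - (s\<^sup>2 - a2 - u - x3)) - y1"
    proof -
      define w where "w = s\<^sup>2 - a2 - u - x3"
      have "k * k * w = (x1 - x3 - k * l)\<^sup>2 - k * k * (a2 + u + x3)"
        unfolding w_def st[symmetric] by (simp add: algebra_simps power2_eq_square)
      then have "k * ((s + l) * (u - x1) + k * (w - x1) + 2 * y1) = 0"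
        using st k_def u_def y12 y32 lm by algebra
      then have "(s + l) * (u - x1) + k * (w - x1) + 2 * y1 = 0" using k by simp
      then have "s * (u - w) - yu = t * (x1 - w) - y1"
        using ts yu_def by algebra
      then show ?thesis unfolding w_def .
    qed
    show ?thesis
      unfolding PQ QR ec_add_eq[OF cu c(3) s] ec_add_eq[OF c(1) cv t] y unfolding x ..
  next
    case True
    \<comment> \<open>Here R lies on the line PQ, and counted with multiplicity it is one of the two
      intersections other than Q: either P or -(P + Q).\<close>
    have "(x1 - x3) * (u - x3) = 0"
      using lm u_def y12 y32 True by algebra
    then consider "x1 = x3" | "u = x3" by auto
    then show ?thesis
    proof cases
      case 1
      then have "y1 = y3" using y12 y32 True by (metis diff_add_cancel)
      then show ?thesis
        using 1 PQ QR ec_add_comm[of "Affine x1 y1" "Affine x2 y2"] ec_add_comm[of "Affine x1 y1" "Affine u yu"]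
          c cu by simp
    next
      case 2
      then have "v = x1" using True by (simp add: u_def v_def algebra_simps)
      moreover have y32': "y3 - y2 = l * (x3 - x2)" using y32 True by simp
      have "l * (x1 - x3) = y1 - y3" "l * (x3 - x1) = y3 - y1" using y12 y32' by algebra+
      then have "yu = - y3" "yv = - y1"
        unfolding yu_def yv_def using 2 \<open>v = x1\<close> True by simp_all
      ultimately show ?thesis using PQ QR 2 by simp
    qed
  qed
qed

lemma ec_add_assoc:
  assumes P: "P \<in> ec_points cubic" and Q: "Q \<in> ec_points cubic" and R: "R \<in> ec_points cubic"
  shows "ec_add cubic (ec_add cubic P Q) R = ec_add cubic P (ec_add cubic Q R)"
proof (rule ec_sum_cases[OF P Q])
  assume "P = ec_neg Q"
  then show ?thesis using ec_add_cancel_left[OF Q R] by simp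
next
  fix x1 y1 x2 y2 l assume *: "P = Affine x1 y1" "Q = Affine x2 y2" "on_curve x1 y1" "on_curve x2 y2"
    "is_slope l x1 y1 x2 y2"
  show ?thesis
  proof (rule ec_sum_cases[OF Q R])
    assume "Q = ec_neg R"
    moreover have "ec_add cubic (ec_add cubic P (ec_neg R)) R = P"
      using ec_add_cancel_left[of "ec_neg R" P] ec_add_comm ec_neg_closed ec_add_closed P R
      by (metis ec_neg_neg)
    ultimately show ?thesis by simp
  next
    fix x3 y3 x4 y4 m assume "Q = Affine x3 y3" "R = Affine x4 y4" "on_curve x3 y3" "on_curve x4 y4"
    "is_slope m x3 y3 x4 y4"
    then show ?thesis using * ec_add_assoc_affine by auto
  qed (use * in auto)
qed auto

theorem comm_group_ec_group: "comm_group (ec_group cubic)"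
proof (rule comm_groupI)
  show "P \<otimes>\<^bsub>ec_group cubic\<^esub> Q = Q \<otimes>\<^bsub>ec_group cubic\<^esub> P"
    if "P \<in> carrier (ec_group cubic)" "Q \<in> carrier (ec_group cubic)" for P Q
    using that ec_add_comm by (simp add: ec_group_def)
  fix P assume "P \<in> carrier (ec_group cubic)"
  then show "\<exists>Q\<in>carrier (ec_group cubic). Q \<otimes>\<^bsub>ec_group cubic\<^esub> P = \<one>\<^bsub>ec_group cubic\<^esub>"
    using ec_neg_closed by (intro bexI[of _ "ec_neg P"]) (auto simp: ec_group_def)
qed (simp_all add: ec_group_def ec_add_closed ec_add_assoc)

end

section \<open>Descent over the integers\<close>

text \<open>The residues 1 and 7 are closed under multiplication modulo 8, so an odd
  \<open>n\<close> outside these two classes cannot have all its prime factors inside them.\<close>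

lemma prime_factor_mod_8:
  fixes n :: nat
  assumes "n mod 8 \<in> {3, 5}"
  shows "\<exists>r. prime r \<and> r dvd n \<and> r mod 8 \<in> {3, 5}"
  using assms
proof (induction n rule: less_induct)
  case (less n)
  then have "n \<noteq> 1" by auto
  then obtain r where r: "prime r" "r dvd n" using prime_factor_nat by blast
  then obtain m where m: "n = r * m" by auto
  show ?case
  proof (cases "r mod 8 \<in> {3, 5}")
    case False
    have "(r mod 8) * (m mod 8) mod 8 \<in> {3, 5}" using less.prems m by (simp add: mod_mult_eq)
    moreover have "r mod 8 < 8" "m mod 8 < 8" by simp_all
    then have "r mod 8 \<in> {0,1,2,3,4,5,6,7}" "m mod 8 \<in> {0,1,2,3,4,5,6,7}" by auto
    ultimately have "m mod 8 \<in> {3, 5}" using False by auto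
    moreover have "m \<noteq> 0" using m less.prems by (cases "m = 0") auto
    with m prime_gt_1_nat[OF r(1)] have "m < n" by simp
    ultimately obtain r' where "prime r'" "r' dvd m" "r' mod 8 \<in> {3, 5}" using less.IH by blast
    then show ?thesis using m dvd_mult by blast
  qed (use r in blast)
qed

lemma odd_square_mod_8:
  fixes t :: int
  assumes "odd t"
  shows "t\<^sup>2 mod 8 = 1"
proof -
  have "t mod 8 \<in> {0,1,2,3,4,5,6,7}" by auto
  moreover have "odd (t mod 8)" using assms by presburger
  ultimately have "t mod 8 \<in> {1,3,5,7}" by auto
  moreover have "t\<^sup>2 mod 8 = (t mod 8)\<^sup>2 mod 8" by (simp add: power_mod)
  ultimately show ?thesis by auto
qed

text \<open>
  Lagrange's descent: an odd root \<open>t < l\<close> of \<open>t\<^sup>2 = 2\<close> modulo \<open>l\<close> gives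
  \<open>t\<^sup>2 - 2 = l f\<close> with \<open>f < l\<close> and \<open>f\<close> again congruent to 3 or 5 modulo 8.
\<close>
lemma two_nonresidue:
  fixes l :: nat and t :: int
  assumes "prime l" "l mod 8 \<in> {3, 5}"
  shows "\<not> int l dvd t\<^sup>2 - 2"
  using assms
proof (induction l arbitrary: t rule: less_induct)
  case (less l)
  show ?case
  proof
    assume t: "int l dvd t\<^sup>2 - 2"
    have l: "l > 1" "odd l" using less.prems prime_gt_1_nat by auto presburger+
    define t1 where "t1 = t mod int l"
    have t1: "int l dvd t1\<^sup>2 - 2" "0 \<le> t1" "t1 < int l"
    proof -
      have "(t1\<^sup>2 - 2) mod int l = (t\<^sup>2 - 2) mod int l"
        unfolding t1_def by (metis mod_diff_left_eq power_mod)
      then show "int l dvd t1\<^sup>2 - 2" using t by (simp add: dvd_eq_mod_eq_0)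
    qed (use l in \<open>auto simp: t1_def\<close>)
    \<comment> \<open>Since \<open>l\<close> is odd, one of the two roots \<open>t1\<close> and
      \<open>l - t1\<close> is odd. The value \<open>u = int l\<close> arises from
      \<open>t1 = 0\<close>; the bound \<open>f < int l\<close> survives it because of the
      subtracted 2.\<close>
    define u where "u = (if odd t1 then t1 else int l - t1)"
    have u: "int l dvd u\<^sup>2 - 2" "odd u" "0 < u" "u < int l \<or> u = int l"
    proof -
      have "(int l - t1)\<^sup>2 - 2 = (t1\<^sup>2 - 2) + int l * (int l - 2 * t1)"
        by (simp add: algebra_simps power2_eq_square)
      moreover have "int l dvd (t1\<^sup>2 - 2) + int l * (int l - 2 * t1)"
        using t1(1) by (rule dvd_add) simp
      ultimately show "int l dvd u\<^sup>2 - 2" using t1(1) unfolding u_def by metis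
      show "odd u" using l unfolding u_def by auto
      show "0 < u" using t1 unfolding u_def by (cases "t1 = 0") auto
      show "u < int l \<or> u = int l" using t1 unfolding u_def by auto
    qed
    obtain f where f: "u\<^sup>2 - 2 = int l * f" using u(1) by auto
    have "u \<noteq> 1"
    proof
      assume "u = 1"
      then have "int l dvd 1" using u(1) by simp
      then show False using l by simp
    qed
    then have u3: "u \<ge> 3" using u(2,3) by presburger
    have "u\<^sup>2 > 2" using u3 power_mono[of 3 u 2] by simp
    then have fpos: "f > 0" using f l by (metis diff_gt_0_iff_gt of_nat_0_less_iff zero_less_mult_pos less_trans zero_less_one)
    have "u\<^sup>2 \<le> (int l)\<^sup>2" using u by (intro power_mono) auto
    then have "int l * f < int l * int l" using f by (simp add: power2_eq_square)
    then have fl: "f < int l" using l by simp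
    define g where "g = nat f"
    have g: "int g = f" using fpos by (simp add: g_def)
    \<comment> \<open>As \<open>u\<close> is odd, the product of \<open>l\<close> and
      \<open>f\<close> is -1 modulo 8, so a factor 3 or 5 forces the other one to be 5 or 3.\<close>
    have "int ((l mod 8) * (g mod 8) mod 8) = (u\<^sup>2 - 2) mod 8"
      by (simp add: f g[symmetric] zmod_int mod_mult_eq)
    also have "\<dots> = 7"
      using odd_square_mod_8[OF u(2)] by presburger
    finally have "(l mod 8) * (g mod 8) mod 8 = 7" by linarith
    moreover have "g mod 8 < 8" by simp
    then have "g mod 8 \<in> {0,1,2,3,4,5,6,7}" by auto
    ultimately have "g mod 8 \<in> {3, 5}" using less.prems(2) by auto
    then obtain r where r: "prime r" "r dvd g" "r mod 8 \<in> {3, 5}" using prime_factor_mod_8 by blast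
    have "r < l" using r(2) fl fpos g by (metis dvd_imp_le le_less_trans of_nat_0_less_iff of_nat_less_iff)
    moreover have "int r dvd u\<^sup>2 - 2" using f g r(2) by (metis dvd_mult of_nat_dvd_iff)
    ultimately show False using less.IH r by blast
  qed
qed

text \<open>The norm form of Z[sqrt 2] is anisotropic modulo a prime for which 2 is a non-residue:
  an invertible \<open>v\<close> would give the square root \<open>u / v\<close> of 2.\<close>

lemma prime_dvd_square_minus_two_squares:
  fixes l :: nat and u v :: int
  assumes l: "prime l" "l mod 8 \<in> {3, 5}" and d: "int l dvd u\<^sup>2 - 2 * v\<^sup>2"
  shows "int l dvd v" "int l dvd u"
proof -
  show v: "int l dvd v"
  proof (rule ccontr)
    assume "\<not> int l dvd v"
    then have "coprime v (int l)"
      using l(1) prime_imp_coprime[of "int l" v] by (simp add: coprime_commute)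
    then obtain w where w: "[v * w = 1] (mod int l)" using cong_solve_coprime_int by blast
    then have w': "int l dvd v * w - 1" by (simp add: cong_iff_dvd_diff)
    have "(u * w)\<^sup>2 - 2 = w\<^sup>2 * (u\<^sup>2 - 2 * v\<^sup>2) + (v * w - 1) * (2 * (v * w + 1))"
      by (simp add: algebra_simps power2_eq_square)
    then have "int l dvd (u * w)\<^sup>2 - 2" using d w' by (metis dvd_add dvd_mult dvd_mult2)
    then show False using two_nonresidue l by blast
  qed
  have "int l dvd (u\<^sup>2 - 2 * v\<^sup>2) + v * (2 * v)" using d v by (intro dvd_add) auto
  then have "int l dvd u\<^sup>2" by (simp add: power2_eq_square)
  then show "int l dvd u" using l(1) prime_dvd_power[of "int l" u 2] by simp
qed

section \<open>Squarefree parts of the factors of a square\<close>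

lemma squarefree_dvd_square:
  fixes d w :: int
  assumes sf: "squarefree d" and dw: "d dvd w\<^sup>2"
  shows "d dvd w"
proof -
  have "d \<noteq> 0" using squarefreeD[OF sf, of 0] by auto
  then have g: "gcd d w \<noteq> 0" by simp
  then obtain d' w' where dw': "d = d' * gcd d w" "w = w' * gcd d w" "coprime d' w'"
    using gcd_coprime_exists by blast
  obtain m where "w\<^sup>2 = d * m" using dw by auto
  then have "gcd d w * (gcd d w * w'\<^sup>2) = gcd d w * (d' * m)"
    using dw'(1,2) by (metis power2_eq_square mult.assoc mult.commute mult.left_commute)
  then have "gcd d w * w'\<^sup>2 = d' * m" using g by (metis mult_cancel_left)
  then have "d' dvd gcd d w * w'\<^sup>2" by simp
  \<comment> \<open>Hence the square of \<open>d'\<close> divides \<open>d\<close>, and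
    squarefreeness makes \<open>d'\<close> a unit.\<close>
  then have "d' dvd gcd d w" using dw'(3) by (simp add: coprime_dvd_mult_left_iff)
  then have "d'\<^sup>2 dvd d" using dw'(1) by (metis dvd_refl mult_dvd_mono power2_eq_square)
  then have "is_unit d'" using squarefreeD[OF sf] by blast
  then have "d dvd gcd d w" using dw'(1) by (metis dvd_refl mult_unit_dvd_iff')
  then show ?thesis by simp
qed

text \<open>For the squarefree part d of n, the product d m is itself a square w^2, so d divides w
  and d^2 divides d m. Thus d is a common divisor of \<open>n\<close> and \<open>m\<close>, which
  confines it as soon as \<open>m\<close> is known modulo \<open>n\<close>.\<close>

lemma square_factor_squarefree:
  fixes n m z :: int
  assumes "n * m = z\<^sup>2" "n \<noteq> 0"
  shows "\<exists>d k. n = d * k\<^sup>2 \<and> squarefree d \<and> d dvd m"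
proof -
  define d where "d = squarefree_part n"
  define k where "k = square_part n"
  have n: "n = d * k\<^sup>2" unfolding d_def k_def by (rule squarefree_decompose)
  have sf: "squarefree d" unfolding d_def by (rule squarefree_squarefree_part)
  have "k \<noteq> 0" using n assms(2) by auto
  have "k\<^sup>2 dvd z\<^sup>2" using assms(1) n by (metis dvd_mult2 dvd_triv_right)
  then have "k dvd z" by simp
  then obtain w where w: "z = k * w" by auto
  have "k\<^sup>2 * (d * m) = k\<^sup>2 * w\<^sup>2" using assms(1) n w by (simp add: algebra_simps power2_eq_square)
  then have dm: "d * m = w\<^sup>2" using \<open>k \<noteq> 0\<close> by simp
  then have "d dvd w\<^sup>2" by (metis dvd_triv_left)
  then have "d dvd w" using sf squarefree_dvd_square by blast
  then have "d * d dvd d * m" unfolding dm power2_eq_square by (rule mult_dvd_mono) fact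
  then have "d dvd m" using n assms(2) by auto
  then show ?thesis using n sf by blast
qed

lemma abs_dvd_prime_product:
  fixes p q :: nat and d :: int
  assumes "prime p" "prime q" "d dvd int p * int q"
  shows "\<bar>d\<bar> \<in> {1, int p, int q, int p * int q}"
proof -
  have "nat \<bar>d\<bar> dvd p * q" using assms(3) by (metis nat_abs_dvd_iff of_nat_mult nat_int)
  then obtain b c where bc: "nat \<bar>d\<bar> = b * c" "b dvd p" "c dvd q"
    using division_decomp by blast
  then have "b = 1 \<or> b = p" "c = 1 \<or> c = q" using assms(1,2) prime_nat_iff by auto
  then have "nat \<bar>d\<bar> \<in> {1, p, q, p * q}" using bc(1) by auto
  moreover have "\<bar>d\<bar> = int (nat \<bar>d\<bar>)" by simp
  ultimately show ?thesis by (auto simp flip: of_nat_mult)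
qed


section \<open>Residue conditions at p and q, and the integral 2-descent\<close>

locale twin_primes =
  fixes p q :: nat
  assumes prime_p: "prime p" and prime_q: "prime q" and q_eq: "q = p + 2" and p_mod_8: "p mod 8 = 3"
    and q_sum: "\<exists>a b. int q = a\<^sup>2 + b\<^sup>2"
begin

lemma q_mod_8: "q mod 8 = 5"
  using p_mod_8 unfolding q_eq by presburger

lemma int_q: "int q = int p + 2"
  by (simp add: q_eq)

lemma prime_int_p: "prime (int p)" and prime_int_q: "prime (int q)"
  using prime_p prime_q by simp_all

lemma p_ge_3: "p \<ge> 3"
  using p_mod_8 by (cases "p < 3") (auto simp: less_Suc_eq numeral_3_eq_3)

lemma not_q_dvd_small: "\<not> int q dvd int p" "\<not> int q dvd 2" "\<not> int p dvd 2" "\<not> int p dvd int q"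
proof -
  show "\<not> int q dvd int p" "\<not> int q dvd 2" "\<not> int p dvd 2"
    using p_ge_3 q_eq by (auto dest: zdvd_imp_le)
  then show "\<not> int p dvd int q" unfolding int_q by (metis dvd_add_right_iff dvd_refl)
qed

text \<open>Modulo q the quotient a / b is a square root of -1, and multiplying by it turns the form
  with the plus sign into the one with the minus sign.\<close>

lemma q_dvd_square_pm_two_squares:
  fixes u v :: int
  assumes "int q dvd u\<^sup>2 - 2 * v\<^sup>2 \<or> int q dvd u\<^sup>2 + 2 * v\<^sup>2"
  shows "int q dvd v"
  using assms
proof
  assume *: "int q dvd u\<^sup>2 + 2 * v\<^sup>2"
  obtain a b where ab: "int q = a\<^sup>2 + b\<^sup>2" using q_sum by blast
  have "(a * u)\<^sup>2 - 2 * (b * v)\<^sup>2 = int q * u\<^sup>2 - b\<^sup>2 * (u\<^sup>2 + 2 * v\<^sup>2)"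
    unfolding ab by (simp add: algebra_simps power2_eq_square)
  then have "int q dvd (a * u)\<^sup>2 - 2 * (b * v)\<^sup>2" using * by (metis dvd_diff dvd_mult dvd_triv_left)
  then have "int q dvd b * v"
    using prime_dvd_square_minus_two_squares(1) prime_q q_mod_8 by blast
  moreover have "\<not> int q dvd b"
  proof
    assume b: "int q dvd b"
    then have "int q dvd a\<^sup>2 + b\<^sup>2 - b * b" using ab by (intro dvd_diff) auto
    then have "int q dvd a\<^sup>2" by (simp add: power2_eq_square)
    then have a: "int q dvd a" using prime_dvd_power prime_int_q by blast
    have "int q * int q dvd a * a + b * b" using a b by (intro dvd_add mult_dvd_mono) 
    then have "int q * int q dvd int q" using ab by (simp add: power2_eq_square)
    then show False using p_ge_3 q_eq by (auto dest: zdvd_imp_le)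
  qed
  ultimately show ?thesis using prime_int_q prime_dvd_mult_iff by blast
qed (use prime_dvd_square_minus_two_squares(1) prime_q q_mod_8 in blast)

end

context twin_primes begin

lemma prime_dvd_square: "prime l \<Longrightarrow> l dvd z\<^sup>2 \<Longrightarrow> l dvd z" for l z :: int
  using prime_dvd_power by blast

text \<open>The squarefree parts \<open>d1\<close> of \<open>r\<close> and \<open>d3\<close> of
  \<open>r + q * s\<close> divide the product of the remaining factors, hence p q and 2 q; the
  middle factor enters through \<open>d1 * t * d3\<close> being a square. The four alternatives are,
  up to the sign \<open>\<sigma>\<close>, the classes of \<open>Infinity\<close>, (0,0), (-p,0) and
  (-q,0).\<close>

lemma integral_descent:
  fixes r s Y :: int
  assumes rs: "coprime r s" "s > 0"
    and Y: "Y\<^sup>2 = r * (r + int p * s) * (r + int q * s) * s" "Y \<noteq> 0"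
  shows "\<exists>e \<alpha> \<gamma> \<sigma>. s = e\<^sup>2 \<and> \<sigma> \<in> {1, -1} \<and>
    (r = \<sigma> * \<alpha>\<^sup>2 \<and> r + int q * s = \<gamma>\<^sup>2 \<or>
     r = \<sigma> * (int p * int q) * \<alpha>\<^sup>2 \<and> r + int q * s = int q * \<gamma>\<^sup>2 \<or>
     r = \<sigma> * int p * \<alpha>\<^sup>2 \<and> r + int q * s = 2 * \<gamma>\<^sup>2 \<or>
     r = \<sigma> * int q * \<alpha>\<^sup>2 \<and> r + int q * s = 2 * int q * \<gamma>\<^sup>2)"
proof -
  define t where "t = r + int p * s"
  define w where "w = r + int q * s"
  have nz: "r \<noteq> 0" "t \<noteq> 0" "w \<noteq> 0" "s \<noteq> 0" using Y unfolding t_def w_def by auto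
  have pos: "r * t * w > 0"
  proof -
    have "r * t * w * s > 0" using Y unfolding t_def w_def by (metis zero_less_power2)
    then show ?thesis using rs(2) by (simp add: zero_less_mult_iff)
  qed
  have "t > r" "w > t" using rs(2) p_ge_3 unfolding t_def w_def int_q by (auto simp: algebra_simps)
  \<comment> \<open>Three negative factors would have a negative product. Thus \<open>d3\<close> is
    positive and the only free sign is that of \<open>d1\<close>.\<close>
  have w: "w > 0"
  proof (rule ccontr)
    assume "\<not> w > 0"
    then have "r < 0" "t < 0" "w < 0" using \<open>t > r\<close> \<open>w > t\<close> nz by auto
    then show False using pos by (simp add: mult_less_0_iff zero_less_mult_iff)
  qed
  then have rt: "r * t > 0" using pos by (simp add: zero_less_mult_iff)
  have Y2: "r * t * w * s = Y\<^sup>2" using Y(1) by (simp add: t_def w_def)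

  have "s * (r * t * w) = Y\<^sup>2" using Y2 by (simp add: mult_ac)
  from square_factor_squarefree[OF this \<open>s \<noteq> 0\<close>] obtain d0 e where
    d0: "s = d0 * e\<^sup>2" "d0 dvd r * t * w" by blast
  have "coprime s (r + k * s)" for k
    using rs(1) by (metis add.commute coprime_commute coprime_iff_gcd_eq_1 gcd_add_mult)
  then have "coprime s t" "coprime s w" unfolding t_def w_def by blast+
  moreover have "coprime s r" using rs(1) by (simp add: coprime_commute)
  ultimately have "coprime d0 (r * t * w)" using d0(1)
    by (metis coprime_divisors coprime_mult_right_iff dvd_refl dvd_triv_left)
  then have "is_unit d0" using d0(2) by (meson coprime_common_divisor dvd_refl)
  then have "d0 = 1" using d0(1) rs(2)
    by (auto simp: zdvd1_eq abs_if mult_less_0_iff split: if_splits)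
  then have s: "s = e\<^sup>2" using d0(1) by simp

  have "r * (t * w * s) = Y\<^sup>2" using Y2 by (simp add: mult_ac)
  from square_factor_squarefree[OF this \<open>r \<noteq> 0\<close>] obtain d1 \<alpha> where
    d1: "r = d1 * \<alpha>\<^sup>2" "d1 dvd t * w * s" by blast
  have d1r: "d1 dvd r" using d1(1) by simp
  \<comment> \<open>Modulo \<open>r\<close>, the factors \<open>t\<close> and \<open>w\<close> are
    \<open>p * s\<close> and \<open>q * s\<close>.\<close>
  have "t * w * s = int p * int q * s^3 + r * ((r + (int p + int q) * s) * s)"
    by (simp add: t_def w_def algebra_simps power3_eq_cube)
  then have "d1 dvd int p * int q * s^3" using d1(2) d1r by (metis dvd_add_left_iff dvd_mult2)
  moreover have "coprime d1 (s^3)" using d1r rs(1) by (metis coprime_divisors coprime_power_right_iff dvd_refl)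
  ultimately have "d1 dvd int p * int q" by (simp add: coprime_dvd_mult_left_iff)
  then have d1c: "\<bar>d1\<bar> \<in> {1, int p, int q, int p * int q}"
    using abs_dvd_prime_product prime_p prime_q by blast

  have "w * (r * t * s) = Y\<^sup>2" using Y2 by (simp add: mult_ac)
  from square_factor_squarefree[OF this \<open>w \<noteq> 0\<close>] obtain d3 \<gamma> where
    d3: "w = d3 * \<gamma>\<^sup>2" "d3 dvd r * t * s" by blast
  have d3w: "d3 dvd w" using d3(1) by simp
  \<comment> \<open>Modulo \<open>w\<close>, the factors \<open>r\<close> and \<open>t\<close> are
    \<open>- q * s\<close> and \<open>- 2 * s\<close>.\<close>
  have "r * t * s = int 2 * int q * s^3 + w * ((r - 2 * s) * s)"
    unfolding t_def w_def int_q by (simp add: algebra_simps power3_eq_cube)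
  then have "d3 dvd int 2 * int q * s^3" using d3(2) d3w by (metis dvd_add_left_iff dvd_mult2)
  moreover have "coprime d3 (s^3)"
    using d3w \<open>coprime s w\<close> by (metis coprime_commute coprime_divisors coprime_power_right_iff dvd_refl)
  ultimately have "d3 dvd int 2 * int q" by (simp add: coprime_dvd_mult_left_iff)
  then have "\<bar>d3\<bar> \<in> {1, int 2, int q, int 2 * int q}"
    using abs_dvd_prime_product two_is_prime_nat prime_q by blast
  moreover have "d3 > 0" using d3(1) w by (simp add: zero_less_mult_iff)
  ultimately have d3c: "d3 \<in> {1, 2, int q, 2 * int q}" by auto

  define \<sigma> where "\<sigma> = sgn d1"
  have "d1 \<noteq> 0" using d1(1) nz by auto
  then have \<sigma>: "\<sigma> \<in> {1, -1}" "d1 = \<sigma> * \<bar>d1\<bar>" by (auto simp: \<sigma>_def sgn_if)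
  have \<sigma>\<sigma>: "\<sigma> * \<sigma> = 1" using \<sigma>(1) by auto

  have "(\<alpha> * \<gamma> * e)\<^sup>2 * (d1 * t * d3) = Y\<^sup>2"
    unfolding Y2[symmetric] by (subst d1(1), subst d3(1), subst s) (simp add: power2_eq_square mult_ac)
  then have "(\<alpha> * \<gamma> * e)\<^sup>2 dvd Y\<^sup>2" by (metis dvd_triv_left)
  then have "\<alpha> * \<gamma> * e dvd Y" by simp
  then obtain Z where Z: "Y = \<alpha> * \<gamma> * e * Z" by auto
  then have "(\<alpha> * \<gamma> * e)\<^sup>2 * (d1 * t * d3) = (\<alpha> * \<gamma> * e)\<^sup>2 * Z\<^sup>2"
    using \<open>(\<alpha> * \<gamma> * e)\<^sup>2 * (d1 * t * d3) = Y\<^sup>2\<close> by (simp add: power_mult_distrib)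
  then have key: "d1 * t * d3 = Z\<^sup>2" using Y(2) Z by simp

  have qs: False if "int q dvd r" "int q dvd t"
  proof -
    have "int q dvd int p * s" using that unfolding t_def by (metis dvd_add_right_iff)
    then have "int q dvd s" using prime_dvd_mult_iff[OF prime_int_q] not_q_dvd_small by blast
    then show False using that(1) rs(1) prime_int_q by (meson coprime_common_divisor not_prime_unit)
  qed
  have ps: False if "int p dvd r" "int p dvd e"
  proof -
    have "int p dvd s" using that(2) s by (simp add: power2_eq_square)
    then show False using that(1) rs(1) prime_int_p by (meson coprime_common_divisor not_prime_unit)
  qed
  \<comment> \<open>q divides both \<open>d1\<close> and \<open>d3\<close> or neither: its exponent
    in Z^2 is even, and it cannot divide \<open>t\<close> together with \<open>r\<close>. This claim
    and the next one are the two directions.\<close>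
  have "\<bar>d1\<bar> = 1 \<or> \<bar>d1\<bar> = int p" if "d3 = 1 \<or> d3 = 2"
  proof (rule ccontr)
    assume "\<not> ?thesis"
    then have "\<bar>d1\<bar> = int q * 1 \<or> \<bar>d1\<bar> = int q * int p" using d1c by auto
    then obtain m where m: "\<bar>d1\<bar> = int q * m" "m = 1 \<or> m = int p" by blast
    define d' where "d' = \<sigma> * m"
    have d': "d1 = int q * d'" "d' \<in> {1, -1, int p, - int p}"
      using \<sigma> m unfolding d'_def by (metis mult.left_commute, auto)
    have "int q dvd Z\<^sup>2" unfolding key[symmetric] d'(1) by simp
    then have "int q dvd Z" using prime_dvd_square prime_int_q by blast
    then have "int q * int q dvd int q * (d' * t * d3)"
      using key unfolding d'(1) power2_eq_square by (metis mult.assoc mult_dvd_mono)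
    then have "int q dvd d' * t * d3" using prime_q prime_gt_0_nat by simp
    then have "int q dvd t"
      using that d'(2) not_q_dvd_small prime_int_q by (auto simp: prime_dvd_mult_iff)
    moreover have "int q dvd r" using d1r d'(1) by (metis dvd_mult_left)
    ultimately show False using qs by blast
  qed
  moreover have "\<bar>d1\<bar> = int q \<or> \<bar>d1\<bar> = int p * int q" if "d3 = int q \<or> d3 = 2 * int q"
  proof (rule ccontr)
    assume no: "\<not> ?thesis"
    have "d3 = int q * 1 \<or> d3 = int q * 2" using that by auto
    then obtain d' where d': "d3 = int q * d'" "d' \<in> {1, 2}" by blast
    have "int q dvd Z\<^sup>2" unfolding key[symmetric] d'(1) by simp
    then have "int q dvd Z" using prime_dvd_square prime_int_q by blast
    then have "int q * int q dvd int q * (d1 * t * d')"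
      using key unfolding d'(1) power2_eq_square by (metis mult.assoc mult.commute mult_dvd_mono)
    then have "int q dvd d1 * t * d'" using prime_q prime_gt_0_nat by simp
    moreover have "\<not> int q dvd d1" using no d1c not_q_dvd_small prime_int_q
      by (metis dvd_abs_iff insertE not_prime_unit singletonD)
    ultimately have qt: "int q dvd t"
      using d'(2) not_q_dvd_small prime_int_q by (auto simp: prime_dvd_mult_iff)
    have "int q dvd w" using d3w d'(1) by (metis dvd_mult_left)
    then have "int q dvd r" unfolding w_def by (metis dvd_add_left_iff dvd_triv_left)
    then show False using qs qt by blast
  qed
  \<comment> \<open>Modulo p, q is 2, so \<open>\<gamma>\<close> and \<open>e\<close> give a zero of
    the form u^2 - 2 v^2.\<close>
  moreover have False if "d3 = 1" "\<bar>d1\<bar> = int p"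
  proof -
    have r: "r = int p * (\<sigma> * \<alpha>\<^sup>2)" using d1(1) \<sigma> that by (simp add: mult_ac)
    have "\<gamma>\<^sup>2 - 2 * e\<^sup>2 = int p * (\<sigma> * \<alpha>\<^sup>2 + s)"
      using d3(1) that s unfolding w_def int_q r by (simp add: algebra_simps)
    then have "int p dvd e" using prime_dvd_square_minus_two_squares prime_p p_mod_8
      by (metis dvd_triv_left insertI1)
    then show False using ps r by simp
  qed
  \<comment> \<open>Now \<open>\<sigma> * r\<close> is a square and \<open>\<sigma> * t\<close>
    twice a square, with difference a multiple of p. Anisotropy makes this difference divisible by
    p^2, so p divides \<open>s\<close> as well as \<open>r\<close>.\<close>
  moreover have False if "d3 = 2" "\<bar>d1\<bar> = 1"
  proof -
    have "2 dvd Z\<^sup>2" using key that by (metis dvd_triv_right)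
    then have "2 dvd Z" by simp
    then obtain Z' where Z': "Z = 2 * Z'" by auto
    have "d1 = \<sigma>" using \<sigma> that by simp
    then have t2: "\<sigma> * t = 2 * Z'\<^sup>2" using key that Z' by (simp add: power2_eq_square)
    have "\<alpha>\<^sup>2 - 2 * Z'\<^sup>2 = \<sigma> * (r - t)"
      using d1(1) \<open>d1 = \<sigma>\<close> t2 \<sigma>\<sigma> by (simp add: algebra_simps)
    also have "\<dots> = int p * (- \<sigma> * s)" by (simp add: t_def)
    finally have "int p dvd \<alpha>\<^sup>2 - 2 * Z'\<^sup>2" by simp
    then have pz: "int p dvd Z'" "int p dvd \<alpha>"
      using prime_dvd_square_minus_two_squares prime_p p_mod_8 by (metis insertI1)+
    then have "int p * int p dvd \<alpha> * \<alpha> - 2 * (Z' * Z')"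
      by (intro dvd_diff dvd_mult mult_dvd_mono)
    then have "int p * int p dvd int p * (- \<sigma> * s)"
      using \<open>\<alpha>\<^sup>2 - 2 * Z'\<^sup>2 = \<sigma> * (r - t)\<close> \<open>\<sigma> * (r - t) = int p * (- \<sigma> * s)\<close> by (simp add: power2_eq_square)
    then have "int p dvd - \<sigma> * s" using p_ge_3 by simp
    then have "int p dvd e\<^sup>2" using \<sigma>(1) s by auto
    then have "int p dvd e" using prime_dvd_square prime_int_p by blast
    moreover have "int p dvd r" using pz(2) d1(1) by (simp add: power2_eq_square)
    ultimately show False using ps by blast
  qed
  \<comment> \<open>Modulo q, p is -2, so the square \<open>\<sigma> * t\<close> is congruent to
    \<open>- 2 * \<sigma>\<close> times a square. The sign is free, so both 2 and -2 must be
    non-residues modulo q.\<close>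
  moreover have False if "d3 = int q" "\<bar>d1\<bar> = int q"
  proof -
    have d1: "r = int q * (\<sigma> * \<alpha>\<^sup>2)" "d1 = int q * \<sigma>" using d1(1) \<sigma> that by (simp_all add: mult_ac)
    have "int q dvd Z\<^sup>2" unfolding key[symmetric] d1(2) by simp
    then have "int q dvd Z" using prime_dvd_square prime_int_q by blast
    then obtain Z' where Z': "Z = int q * Z'" by auto
    have "(int q * int q) * (\<sigma> * t) = (int q * int q) * Z'\<^sup>2"
      using key d1(2) that Z' by (simp add: power2_eq_square mult_ac)
    then have st: "\<sigma> * t = Z'\<^sup>2" using p_ge_3 q_eq by simp
    have "Z'\<^sup>2 + \<sigma> * (2 * e\<^sup>2) = int q * (\<alpha>\<^sup>2 + \<sigma> * s)"
      unfolding st[symmetric] s[symmetric] t_def d1(1) using \<sigma>(1) by (auto simp: int_q algebra_simps)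
    then have "int q dvd Z'\<^sup>2 + \<sigma> * (2 * e\<^sup>2)" by simp
    then have "int q dvd e" using q_dvd_square_pm_two_squares[of Z' e] \<sigma>(1) by auto
    then have "int q dvd s" using s by (simp add: power2_eq_square)
    then have "int q dvd t" using d1(1) by (simp add: t_def)
    then show False using qs d1(1) by simp
  qed
  \<comment> \<open>After division by q, the equation for \<open>w\<close> makes e^2 congruent to 2
    \<open>\<gamma>\<close>^2 modulo p.\<close>
  moreover have False if "d3 = 2 * int q" "\<bar>d1\<bar> = int p * int q"
  proof -
    have r: "r = int q * (int p * (\<sigma> * \<alpha>\<^sup>2))" using d1(1) \<sigma> that by (simp add: mult_ac)
    have "int q * (2 * \<gamma>\<^sup>2) = int q * (int p * (\<sigma> * \<alpha>\<^sup>2) + s)"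
      using d3(1) that unfolding w_def r by (simp add: algebra_simps)
    then have "2 * \<gamma>\<^sup>2 = int p * (\<sigma> * \<alpha>\<^sup>2) + e\<^sup>2" using p_ge_3 q_eq s by simp
    then have "e\<^sup>2 - 2 * \<gamma>\<^sup>2 = int p * (- (\<sigma> * \<alpha>\<^sup>2))" by simp
    then have "int p dvd e" using prime_dvd_square_minus_two_squares prime_p p_mod_8
      by (metis dvd_triv_left insertI1)
    then show False using ps r by simp
  qed
  ultimately have "d3 = 1 \<and> \<bar>d1\<bar> = 1 \<or> d3 = int q \<and> \<bar>d1\<bar> = int p * int q \<or>
      d3 = 2 \<and> \<bar>d1\<bar> = int p \<or> d3 = 2 * int q \<and> \<bar>d1\<bar> = int q"
    using d3c by blast
  then have "r = \<sigma> * \<alpha>\<^sup>2 \<and> w = \<gamma>\<^sup>2 \<or> r = \<sigma> * (int p * int q) * \<alpha>\<^sup>2 \<and> w = int q * \<gamma>\<^sup>2 \<or>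
     r = \<sigma> * int p * \<alpha>\<^sup>2 \<and> w = 2 * \<gamma>\<^sup>2 \<or> r = \<sigma> * int q * \<alpha>\<^sup>2 \<and> w = 2 * int q * \<gamma>\<^sup>2"
    using d1(1) d3(1) \<sigma>(2) by (metis mult.right_neutral mult_1)
  then show ?thesis using s \<sigma>(1) unfolding w_def by blast
qed

end

section \<open>Rational points modulo doubling\<close>

context elliptic_curve begin

abbreviation "E \<equiv> ec_group cubic"

sublocale E: comm_group E
  by (rule comm_group_ec_group)

lemma carrier_E [simp]: "carrier E = ec_points cubic"
  and mult_E: "P \<otimes>\<^bsub>E\<^esub> Q = ec_add cubic P Q"
  and one_E [simp]: "\<one>\<^bsub>E\<^esub> = Infinity"
  by (simp_all add: ec_group_def)

lemma mult_eq_AffineE: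
  assumes "Affine x1 y1 \<otimes>\<^bsub>E\<^esub> Affine x2 y2 = Affine x3 y3" "on_curve x1 y1" "on_curve x2 y2"
  obtains l where "is_slope l x1 y1 x2 y2" "x3 = l\<^sup>2 - a2 - x1 - x2" "y3 = l * (x1 - x3) - y1"
proof -
  have "\<not> (x1 = x2 \<and> y1 = - y2)" using assms(1) by (auto simp: mult_E)
  then obtain l where "is_slope l x1 y1 x2 y2" using is_slope_exists assms(2,3) by blast
  then show thesis using that assms ec_add_eq by (auto simp: mult_E)
qed

text \<open>If the line is y = l x + m, then f(x) - (l x + m)^2 is the product of the three
  differences x - xi; evaluate at the root \<open>e\<close>. In other words, x - e is multiplicative
  modulo squares.\<close>

lemma mult_root_square:
  assumes "Affine x1 y1 \<otimes>\<^bsub>E\<^esub> Affine x2 y2 = Affine x3 y3" "on_curve x1 y1" "on_curve x2 y2"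
    and e: "e^3 + a2 * e\<^sup>2 + a4 * e + a6 = 0"
  shows "\<exists>w. (x1 - e) * (x2 - e) * (x3 - e) = w\<^sup>2"
proof -
  obtain l where l: "is_slope l x1 y1 x2 y2" "x3 = l\<^sup>2 - a2 - x1 - x2"
    using mult_eq_AffineE assms(1-3) by metis
  have "y1\<^sup>2 = x1^3 + a2 * x1\<^sup>2 + a4 * x1 + a6" using assms(2) by (simp add: on_curve_def)
  moreover have "y1 - y2 = l * (x1 - x2)"
    "l * (y1 + y2) = x1\<^sup>2 + x1 * x2 + x2\<^sup>2 + a2 * (x1 + x2) + a4"
    using l(1) unfolding is_slope_def by auto
  ultimately have "(x1 - e) * (x2 - e) * (x3 - e) = (l * (e - x1) + y1)\<^sup>2"
    using l(2) e by algebra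
  then show ?thesis by blast
qed

text \<open>The line passes through (e,0), so f(x) - l^2 (x - e)^2 can be divided by x - e;
  evaluation at \<open>e\<close> gives f'(e). This yields the class at the root \<open>e\<close>
  itself, where \<open>mult_root_square\<close> degenerates to 0 = 0.\<close>

lemma mult_two_torsion:
  assumes m: "Affine x1 y1 \<otimes>\<^bsub>E\<^esub> Affine e 0 = Affine x3 y3" and c: "on_curve x1 y1"
    and e: "e^3 + a2 * e\<^sup>2 + a4 * e + a6 = 0"
  shows "(x1 - e) * (x3 - e) = 3 * e\<^sup>2 + 2 * a2 * e + a4"
proof -
  have "on_curve e 0" using e by (simp add: on_curve_def)
  then obtain l where l: "is_slope l x1 y1 e 0" "x3 = l\<^sup>2 - a2 - x1 - e"
    using mult_eq_AffineE m c by metis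
  have "y1\<^sup>2 = x1^3 + a2 * x1\<^sup>2 + a4 * x1 + a6" using c by (simp add: on_curve_def)
  moreover have "y1 = l * (x1 - e)" "l * y1 = x1\<^sup>2 + x1 * e + e\<^sup>2 + a2 * (x1 + e) + a4"
    using l(1) unfolding is_slope_def by auto
  ultimately show ?thesis using l(2) e by algebra
qed

lemma double_root_square:
  assumes "Affine x1 y1 \<otimes>\<^bsub>E\<^esub> Affine x1 y1 = Affine x y" "on_curve x1 y1"
    and e: "e^3 + a2 * e\<^sup>2 + a4 * e + a6 = 0"
  shows "\<exists>w. x - e = w\<^sup>2"
proof -
  obtain w where w: "(x1 - e) * (x1 - e) * (x - e) = w\<^sup>2" using mult_root_square assms by blast
  have "x1 \<noteq> e"
  proof
    assume "x1 = e"
    then have "y1 = 0" using assms(2) e by (simp add: on_curve_def)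
    then show False using assms(1) by (simp add: mult_E)
  qed
  then have "x - e = (w / (x1 - e))\<^sup>2" unfolding power_divide w[symmetric] by (simp add: power2_eq_square)
  then show ?thesis by blast
qed

end

lemma rat_square_int:
  fixes w :: rat
  assumes "w\<^sup>2 = of_int n"
  shows "w \<in> \<int>"
proof -
  obtain r s where rs: "quotient_of w = (r, s)" by (cases "quotient_of w")
  then have w: "w = of_int r / of_int s" and s: "s > 0" and c: "coprime r s"
    using quotient_of_div quotient_of_denom_pos quotient_of_coprime by auto
  have "(of_int (r\<^sup>2) :: rat) = of_int (n * s\<^sup>2)"
    using assms s unfolding w by (simp add: power_divide field_simps)
  then have "r\<^sup>2 = n * s\<^sup>2" by (simp only: of_int_eq_iff)
  then have "s\<^sup>2 dvd r\<^sup>2" by simp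
  then have "s dvd r" by simp
  then have "is_unit s" using c by (metis coprime_common_divisor dvd_refl)
  then have "s = 1" using s by simp
  then show ?thesis using w by simp
qed

lemma prime_times_not_rat_square:
  fixes l :: int and m :: int and w :: rat
  assumes "prime l" "\<not> l dvd m"
  shows "w\<^sup>2 \<noteq> of_int (l * m)"
proof
  assume w: "w\<^sup>2 = of_int (l * m)"
  then obtain k where "w = of_int k" using rat_square_int Ints_cases by metis
  then have "(of_int (k\<^sup>2) :: rat) = of_int (l * m)" using w by simp
  then have k: "k\<^sup>2 = l * m" by (simp only: of_int_eq_iff)
  then have "l dvd k\<^sup>2" by simp
  then have "l dvd k" using assms(1) prime_dvd_power by blast
  then have "l * l dvd l * m" unfolding k[symmetric] power2_eq_square by (rule mult_dvd_mono) fact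
  then show False using assms by auto
qed

sublocale twin_primes \<subseteq> elliptic_curve "of_nat p + of_nat q :: rat" "of_nat p * of_nat q" 0
proof
  fix x :: rat
  let ?p = "of_nat p :: rat" and ?q = "of_nat q :: rat"
  assume "x^3 + (?p + ?q) * x\<^sup>2 + ?p * ?q * x + 0 = 0"
  then have "x * (x + ?p) * (x + ?q) = 0" by (simp add: algebra_simps power2_eq_square power3_eq_cube)
  then consider "x = 0" | "x = - ?p" | "x = - ?q" by (auto simp: add_eq_0_iff2)
  then show "3 * x\<^sup>2 + 2 * (?p + ?q) * x + ?p * ?q \<noteq> 0"
  proof cases
    case 1
    then show ?thesis using p_ge_3 q_eq by simp
  next
    case 2
    have "3 * x\<^sup>2 + 2 * (?p + ?q) * x + ?p * ?q = - 2 * ?p"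
      by (simp add: 2 q_eq algebra_simps power2_eq_square)
    then show ?thesis using p_ge_3 by simp
  next
    case 3
    have "3 * x\<^sup>2 + 2 * (?p + ?q) * x + ?p * ?q = 2 * ?q"
      by (simp add: 3 q_eq algebra_simps power2_eq_square)
    then show ?thesis using p_ge_3 q_eq by simp
  qed
qed simp

context twin_primes begin

abbreviation "p' \<equiv> of_nat p :: rat"
abbreviation "q' \<equiv> of_nat q :: rat"

lemma q'_eq: "q' = p' + 2" by (simp add: q_eq)

lemma p'_pos: "p' > 0" using p_ge_3 by simp

lemma cubic_eq: "cubic = [:0, 1:] * [:p', 1:] * [:q', 1:]"
  by (simp add: cubic_def algebra_simps)

lemma on_curve_iff: "on_curve x y \<longleftrightarrow> y\<^sup>2 = x * (x + p') * (x + q')"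
  by (simp add: on_curve_def algebra_simps power2_eq_square power3_eq_cube)

lemma roots:
  "0^3 + (p' + q') * 0\<^sup>2 + p' * q' * 0 + 0 = 0"
  "(- p')^3 + (p' + q') * (- p')\<^sup>2 + p' * q' * (- p') + 0 = 0"
  "(- q')^3 + (p' + q') * (- q')\<^sup>2 + p' * q' * (- q') + 0 = 0"
  by (simp_all add: algebra_simps power2_eq_square power3_eq_cube)

text \<open>Two of the three square conditions suffice, since the curve equation supplies the
  third.\<close>

lemma halving:
  assumes c: "on_curve x y" and x: "x = u\<^sup>2" "x \<noteq> 0" and xq: "x + q' = w\<^sup>2" "x + q' \<noteq> 0"
  shows "\<exists>R\<in>ec_points cubic. R \<otimes>\<^bsub>E\<^esub> R = Affine x y"
proof -
  \<comment> \<open>Taking the root of x + p from \<open>y\<close> fixes its sign so that y = u v w;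
    the opposite choice would halve the negated point.\<close>
  define v where "v = y / (u * w)"
  have "u \<noteq> 0" "w \<noteq> 0" using x xq by auto
  then have y: "y = u * v * w" by (simp add: v_def)
  have "u\<^sup>2 * w\<^sup>2 * v\<^sup>2 = u\<^sup>2 * w\<^sup>2 * (x + p')"
    using c xq(1) x(1) y unfolding on_curve_iff by (simp add: power_mult_distrib mult_ac)
  then have v: "x + p' = v\<^sup>2" using \<open>u \<noteq> 0\<close> \<open>w \<noteq> 0\<close> by simp
  \<comment> \<open>With this \<open>X\<close>, the values at the three factors are (u+v)(u+w),
    (v+u)(v+w) and (w+u)(w+v), so their product is Y^2.\<close>
  define X where "X = u\<^sup>2 + u * v + u * w + v * w"
  define Y where "Y = (u + v) * (u + w) * (v + w)"
  define l where "l = u + v + w"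
  have pq: "p' = v\<^sup>2 - u\<^sup>2" "q' = w\<^sup>2 - u\<^sup>2" using x v xq by auto
  have cXY: "on_curve X Y"
    unfolding on_curve_iff unfolding pq X_def Y_def by (simp add: algebra_simps power2_eq_square)
  have s: "is_slope l X Y X Y"
    unfolding is_slope_def unfolding pq X_def Y_def l_def by (simp add: algebra_simps power2_eq_square)
  have "l\<^sup>2 - (p' + q') - X - X = x"
    unfolding pq x(1) X_def l_def by (simp add: algebra_simps power2_eq_square)
  moreover have "l * (X - x) - Y = y"
    unfolding y x(1) X_def Y_def l_def by (simp add: algebra_simps power2_eq_square)
  ultimately have "Affine X Y \<otimes>\<^bsub>E\<^esub> Affine X Y = Affine x y"
    using ec_add_eq[OF cXY cXY s] by (simp add: mult_E)
  then show ?thesis using cXY by (intro bexI[of _ "Affine X Y"]) simp_all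
qed

definition two_torsion :: "rat point set" where
  "two_torsion = {Infinity, Affine 0 0, Affine (- p') 0, Affine (- q') 0}"

lemma two_torsion_iff: "P \<in> two_torsion \<longleftrightarrow> P \<in> ec_points cubic \<and> P \<otimes>\<^bsub>E\<^esub> P = Infinity"
proof (cases P)
  case (Affine x y)
  have "ec_add cubic (Affine x y) (Affine x y) = Infinity \<longleftrightarrow> y = 0"
    by (auto simp: Let_def)
  moreover have "on_curve x 0 \<longleftrightarrow> x = 0 \<or> x = - p' \<or> x = - q'"
    by (auto simp: on_curve_iff add_eq_0_iff2)
  ultimately show ?thesis unfolding Affine mult_E by (auto simp: two_torsion_def)
qed (simp add: two_torsion_def mult_E)

lemma integral_y:
  assumes c: "on_curve (of_int r / of_int s) y" and s: "s > 0"
  shows "\<exists>Y. y * (of_int s)\<^sup>2 = of_int Y \<and> Y\<^sup>2 = r * (r + int p * s) * (r + int q * s) * s"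
proof -
  define x where "x = (of_int r / of_int s :: rat)"
  have "(y * (of_int s)\<^sup>2)\<^sup>2 = x * (x + p') * (x + q') * of_int s ^ 4"
    using c unfolding on_curve_iff x_def[symmetric] by (simp add: power_mult_distrib flip: power_mult)
  also have "\<dots> = (x * of_int s) * ((x + p') * of_int s) * ((x + q') * of_int s) * of_int s"
    by (simp add: power4_eq_xxxx mult_ac)
  also have "\<dots> = of_int r * (of_int r + p' * of_int s) * (of_int r + q' * of_int s) * of_int s"
    using s unfolding x_def by (simp add: distrib_right)
  finally have Y: "(y * (of_int s)\<^sup>2)\<^sup>2 = of_int (r * (r + int p * s) * (r + int q * s) * s)" by simp
  then obtain Z where Z: "y * (of_int s)\<^sup>2 = of_int Z" using rat_square_int Ints_cases by metis
  then have "(of_int (Z\<^sup>2) :: rat) = of_int (r * (r + int p * s) * (r + int q * s) * s)"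
    using Y by simp
  then have "Z\<^sup>2 = r * (r + int p * s) * (r + int q * s) * s" by (simp only: of_int_eq_iff)
  then show ?thesis using Z by blast
qed

lemma rational_point_classes:
  assumes c: "on_curve x y" "y \<noteq> 0"
  shows "\<exists>\<sigma> u w. \<sigma> \<in> {1, -1} \<and>
    (x = \<sigma> * u\<^sup>2 \<and> x + q' = w\<^sup>2 \<or> x = \<sigma> * (p' * q') * u\<^sup>2 \<and> x + q' = q' * w\<^sup>2 \<or>
     x = \<sigma> * p' * u\<^sup>2 \<and> x + q' = 2 * w\<^sup>2 \<or> x = \<sigma> * q' * u\<^sup>2 \<and> x + q' = 2 * q' * w\<^sup>2)"
proof -
  obtain r s where "quotient_of x = (r, s)" by (cases "quotient_of x")
  then have x: "x = of_int r / of_int s" and s: "s > 0" and rs: "coprime r s"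
    using quotient_of_div quotient_of_denom_pos quotient_of_coprime by auto
  obtain Z where Z: "y * (of_int s)\<^sup>2 = of_int Z"
    and Z2: "Z\<^sup>2 = r * (r + int p * s) * (r + int q * s) * s"
    using integral_y[OF c(1)[unfolded x] s] by blast
  have "Z \<noteq> 0" using Z c(2) s by auto
  from integral_descent[OF rs s Z2 this] obtain e \<alpha> \<gamma> \<sigma> where d: "s = e\<^sup>2" "\<sigma> \<in> {1, -1}"
    "r = \<sigma> * \<alpha>\<^sup>2 \<and> r + int q * s = \<gamma>\<^sup>2 \<or>
     r = \<sigma> * (int p * int q) * \<alpha>\<^sup>2 \<and> r + int q * s = int q * \<gamma>\<^sup>2 \<or>
     r = \<sigma> * int p * \<alpha>\<^sup>2 \<and> r + int q * s = 2 * \<gamma>\<^sup>2 \<or>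
     r = \<sigma> * int q * \<alpha>\<^sup>2 \<and> r + int q * s = 2 * int q * \<gamma>\<^sup>2"
    by (elim exE conjE)
  define u where "u = (of_int \<alpha> / of_int e :: rat)"
  define w where "w = (of_int \<gamma> / of_int e :: rat)"
  have "e \<noteq> 0" using d(1) s by auto
  have xr: "x = of_int k * u\<^sup>2" if "r = k * \<alpha>\<^sup>2" for k
    using that d(1) by (simp add: x u_def power_divide)
  have xw: "x + q' = of_int k * w\<^sup>2" if "r + int q * s = k * \<gamma>\<^sup>2" for k
  proof -
    have "x + q' = of_int (r + int q * s) / of_int s" using s by (simp add: x field_simps)
    then show ?thesis unfolding that using d(1) by (simp add: w_def power_divide)
  qed
  have "(of_int \<sigma> :: rat) \<in> {1, -1}" using d(2) by auto
  moreover have "x = of_int \<sigma> * u\<^sup>2 \<and> x + q' = w\<^sup>2 \<or> x = of_int \<sigma> * (p' * q') * u\<^sup>2 \<and> x + q' = q' * w\<^sup>2 \<or>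
     x = of_int \<sigma> * p' * u\<^sup>2 \<and> x + q' = 2 * w\<^sup>2 \<or> x = of_int \<sigma> * q' * u\<^sup>2 \<and> x + q' = 2 * q' * w\<^sup>2"
    using d(3) xr[of \<sigma>] xr[of "\<sigma> * (int p * int q)"] xr[of "\<sigma> * int p"] xr[of "\<sigma> * int q"]
      xw[of 1] xw[of "int q"] xw[of 2] xw[of "2 * int q"] by auto
  ultimately show ?thesis by blast
qed

end

lemma square_mult_cancel:
  fixes a b c x :: "'a::field"
  assumes "a * b * x = w\<^sup>2" "a * b = v\<^sup>2" "a * b \<noteq> 0"
  shows "\<exists>z. x = z\<^sup>2"
proof -
  have "x = (w / v)\<^sup>2" unfolding power_divide assms(1)[symmetric] assms(2)[symmetric]
    using assms(3) by simp
  then show ?thesis by blast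
qed

locale twin_primes_point = twin_primes +
  fixes a b c :: int
  assumes q_sum_squares: "int q = a\<^sup>2 + b\<^sup>2" and c_square: "(a + 1)\<^sup>2 + (b + 1)\<^sup>2 = c\<^sup>2"
begin

text \<open>Expanding the hypothesis gives c^2 = q + 2a + 2b + 2. In the first identity the
  difference of the two bases is q - 2 = p and their sum is c^2; the second uses (a+b)^2 + (a-b)^2 =
  2q.\<close>

lemma coefficients:
  "(int q + a + b)\<^sup>2 - (a + b + 2)\<^sup>2 = int p * c\<^sup>2"
  "(int q + a + b)\<^sup>2 + (a - b)\<^sup>2 = int q * c\<^sup>2"
proof -
  have p: "int p = a\<^sup>2 + b\<^sup>2 - 2" using q_sum_squares int_q by simp
  show "(int q + a + b)\<^sup>2 - (a + b + 2)\<^sup>2 = int p * c\<^sup>2"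
    unfolding p q_sum_squares c_square[symmetric] by (simp add: algebra_simps power2_eq_square)
  show "(int q + a + b)\<^sup>2 + (a - b)\<^sup>2 = int q * c\<^sup>2"
    unfolding q_sum_squares c_square[symmetric] by (simp add: algebra_simps power2_eq_square)
qed

lemma coefficients_nonzero: "c \<noteq> 0" "a - b \<noteq> 0" "a + b + 2 \<noteq> 0" "int q + a + b \<noteq> 0"
proof -
  show c: "c \<noteq> 0"
  proof
    assume "c = 0"
    then have "a + 1 = 0 \<and> b + 1 = 0" using c_square by (simp add: sum_power2_eq_zero_iff)
    then have "a = -1" "b = -1" by auto
    then show False using q_sum_squares p_ge_3 q_eq by simp
  qed
  show "a - b \<noteq> 0"
  proof
    assume "a - b = 0"
    then have "int q = 2 * a\<^sup>2" using q_sum_squares by simp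
    then show False using q_mod_8 by presburger
  qed
  \<comment> \<open>If this sum vanished, then c^2 = q - 2 = p, but a square is never 3 modulo
    8.\<close>
  show "a + b + 2 \<noteq> 0"
  proof
    assume "a + b + 2 = 0"
    then have ab: "a = - b - 2" by simp
    have "int p = c\<^sup>2" using c_square q_sum_squares int_q unfolding ab by (simp add: algebra_simps power2_eq_square)
    then have "c\<^sup>2 mod 8 = 3" using p_mod_8 by presburger
    moreover have "odd n" if "n mod 8 = 3" for n :: int using that by presburger
    ultimately have "odd (c\<^sup>2)" by blast
    then have "odd c" by simp
    then show False using odd_square_mod_8 \<open>c\<^sup>2 mod 8 = 3\<close> by simp
  qed
  then have "(a + b + 2)\<^sup>2 > 0" by simp
  moreover have "int p * c\<^sup>2 \<ge> 0" by simp
  ultimately have "(int q + a + b)\<^sup>2 > 0" using coefficients(1) by linarith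
  then show "int q + a + b \<noteq> 0" by auto
qed

definition gx :: rat where "gx = - (of_int (int q + a + b) / of_int c)\<^sup>2"
definition gy :: rat where
  "gy = of_int (int q + a + b) * of_int (a + b + 2) * of_int (a - b) / of_int c ^ 3"
definition gen :: "rat point" where "gen = Affine gx gy"

lemma gx_p: "gx + p' = - (of_int (a + b + 2) / of_int c)\<^sup>2"
proof -
  have "of_int ((int q + a + b)\<^sup>2 - (a + b + 2)\<^sup>2) = (of_int (int p * c\<^sup>2) :: rat)"
    unfolding coefficients ..
  then have "(of_int (int q + a + b) :: rat)\<^sup>2 - (of_int (a + b + 2))\<^sup>2 = p' * (of_int c)\<^sup>2"
    by (simp only: of_int_diff of_int_mult of_int_power of_int_of_nat_eq)
  then show ?thesis using coefficients_nonzero(1) unfolding gx_def power_divide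
    by (simp add: divide_simps)
qed

lemma gx_q: "gx + q' = (of_int (a - b) / of_int c)\<^sup>2"
proof -
  have "of_int ((int q + a + b)\<^sup>2 + (a - b)\<^sup>2) = (of_int (int q * c\<^sup>2) :: rat)"
    unfolding coefficients ..
  then have "(of_int (int q + a + b) :: rat)\<^sup>2 + (of_int (a - b))\<^sup>2 = q' * (of_int c)\<^sup>2"
    by (simp only: of_int_add of_int_mult of_int_power of_int_of_nat_eq)
  then show ?thesis using coefficients_nonzero(1) unfolding gx_def power_divide
    by (simp add: divide_simps)
qed

lemma on_curve_gen: "on_curve gx gy"
  unfolding on_curve_iff gx_p gx_q unfolding gx_def gy_def
  by (simp only: power_divide power_mult_distrib) (simp add: power_mult_distrib flip: power_mult power_add)

lemma gen_in [simp]: "gen \<in> ec_points cubic"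
  by (simp add: gen_def on_curve_gen)

lemma gen_signs: "gx < 0" "gx + p' < 0" "gx + q' > 0" "gy \<noteq> 0"
  using coefficients_nonzero unfolding gx_p gx_q by (simp_all add: gx_def gy_def)

text \<open>The multiples of \<open>gen\<close> alone would not contain the 2-torsion that the
  descent step produces. This larger subgroup does, and still has rational dimension at most
  one.\<close>

definition half_multiples :: "rat point set" where
  "half_multiples = {Z \<in> ec_points cubic. \<exists>n::int. Z \<otimes>\<^bsub>E\<^esub> Z = gen [^]\<^bsub>E\<^esub> n}"

lemma subgroup_half_multiples: "subgroup half_multiples E"
proof (rule E.subgroupI)
  show "half_multiples \<noteq> {}"
    using E.one_closed int_pow_0[of E gen] E.l_one[of "\<one>\<^bsub>E\<^esub>"]
    by (auto simp: half_multiples_def intro!: exI[of _ Infinity] exI[of _ "0::int"])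
next
  fix Z assume "Z \<in> half_multiples"
  then obtain n :: int where Z: "Z \<in> carrier E" "Z \<otimes>\<^bsub>E\<^esub> Z = gen [^]\<^bsub>E\<^esub> n"
    by (auto simp: half_multiples_def)
  then have "inv\<^bsub>E\<^esub> Z \<otimes>\<^bsub>E\<^esub> inv\<^bsub>E\<^esub> Z = gen [^]\<^bsub>E\<^esub> (- n)"
    by (metis E.inv_mult_group E.int_pow_neg carrier_E gen_in)
  then show "inv\<^bsub>E\<^esub> Z \<in> half_multiples"
    using Z(1) E.inv_closed unfolding half_multiples_def by auto
next
  fix Z W assume "Z \<in> half_multiples" "W \<in> half_multiples"
  then obtain n m :: int where Z: "Z \<in> carrier E" "Z \<otimes>\<^bsub>E\<^esub> Z = gen [^]\<^bsub>E\<^esub> n"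
    and W: "W \<in> carrier E" "W \<otimes>\<^bsub>E\<^esub> W = gen [^]\<^bsub>E\<^esub> m"
    by (auto simp: half_multiples_def)
  have "(Z \<otimes>\<^bsub>E\<^esub> W) \<otimes>\<^bsub>E\<^esub> (Z \<otimes>\<^bsub>E\<^esub> W) = (Z \<otimes>\<^bsub>E\<^esub> Z) \<otimes>\<^bsub>E\<^esub> (W \<otimes>\<^bsub>E\<^esub> W)"
    using Z(1) W(1) by (simp add: E.m_ac del: carrier_E)
  also have "\<dots> = gen [^]\<^bsub>E\<^esub> (n + m)"
    unfolding Z W by (simp add: E.int_pow_mult)
  finally show "Z \<otimes>\<^bsub>E\<^esub> W \<in> half_multiples"
    using E.m_closed[OF Z(1) W(1)] unfolding half_multiples_def by auto
qed (auto simp: half_multiples_def)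

lemma two_torsion_half_multiples: "two_torsion \<subseteq> half_multiples"
  unfolding half_multiples_def using two_torsion_iff by (auto intro!: exI[of _ "0::int"])

lemma gen_half_multiple: "gen \<in> half_multiples"
  unfolding half_multiples_def
  using E.int_pow_mult[of gen 1 1] E.int_pow_1[of gen] by (auto intro!: exI[of _ "2::int"])

lemma half_multiples_cancel:
  assumes "P \<in> ec_points cubic" "P \<otimes>\<^bsub>E\<^esub> Z \<in> half_multiples" "Z \<in> half_multiples"
  shows "P \<in> half_multiples"
proof -
  have P: "P \<in> carrier E" and Z: "Z \<in> carrier E"
    using assms(1,3) by (simp_all add: half_multiples_def)
  have "P = (P \<otimes>\<^bsub>E\<^esub> Z) \<otimes>\<^bsub>E\<^esub> inv\<^bsub>E\<^esub> Z"
    using P Z by (simp add: E.m_assoc del: carrier_E one_E)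
  then show ?thesis
    using assms(2,3) subgroup.m_closed[OF subgroup_half_multiples]
      subgroup.m_inv_closed[OF subgroup_half_multiples] by metis
qed

text \<open>Adding a suitable one of these points makes the class of a given point trivial.
  Finiteness of the set later allows one height constant for all of them.\<close>

definition translates :: "rat point set" where
  "translates = two_torsion \<union> (\<lambda>T. T \<otimes>\<^bsub>E\<^esub> gen) ` two_torsion"

lemma two_torsion_if_y_0: "on_curve x 0 \<Longrightarrow> Affine x 0 \<in> two_torsion"
  by (auto simp: two_torsion_def on_curve_iff add_eq_0_iff2)

text \<open>Adding the 2-torsion point that belongs to the class of \<open>x\<close> cancels it up
  to sign. For (-p,0) and (-q,0) the negative abscissa flips \<open>\<sigma>\<close>.\<close>

lemma two_torsion_translate:
  assumes c: "on_curve x y" "y \<noteq> 0"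
  shows "\<exists>T\<in>two_torsion. \<exists>x' y' \<sigma> u w. Affine x y \<otimes>\<^bsub>E\<^esub> T = Affine x' y' \<and>
    \<sigma> \<in> {1, -1} \<and> x' = \<sigma> * u\<^sup>2 \<and> x' + q' = w\<^sup>2"
proof -
  have x0: "x \<noteq> 0" "x + p' \<noteq> 0" "x + q' \<noteq> 0" using c by (auto simp: on_curve_iff)
  obtain \<sigma> u w where \<sigma>: "\<sigma> \<in> {1, -1}" and cl:
    "x = \<sigma> * u\<^sup>2 \<and> x + q' = w\<^sup>2 \<or> x = \<sigma> * (p' * q') * u\<^sup>2 \<and> x + q' = q' * w\<^sup>2 \<or>
     x = \<sigma> * p' * u\<^sup>2 \<and> x + q' = 2 * w\<^sup>2 \<or> x = \<sigma> * q' * u\<^sup>2 \<and> x + q' = 2 * q' * w\<^sup>2"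
    using rational_point_classes[OF c] by (elim exE conjE)
  have \<sigma>\<sigma>: "\<sigma> * \<sigma> = 1" "- \<sigma> \<in> {1, -1}" "\<sigma> \<noteq> 0" using \<sigma> by auto
  have q0: "q' \<noteq> 0" "p' \<noteq> 0" "q' - p' = 2" using p'_pos q'_eq by auto
  have ec: "\<exists>x' y'. Affine x y \<otimes>\<^bsub>E\<^esub> Affine e 0 = Affine x' y'" for e
    using c(2) by (simp add: mult_E Let_def)
  from cl show ?thesis
  proof (elim disjE)
    assume "x = \<sigma> * u\<^sup>2 \<and> x + q' = w\<^sup>2"
    then show ?thesis using \<sigma>
      by (intro bexI[of _ Infinity] exI[of _ x] exI[of _ y] exI[of _ \<sigma>] exI[of _ u] exI[of _ w])
         (auto simp: mult_E two_torsion_def)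
  next
    assume *: "x = \<sigma> * (p' * q') * u\<^sup>2 \<and> x + q' = q' * w\<^sup>2"
    obtain x' y' where s: "Affine x y \<otimes>\<^bsub>E\<^esub> Affine 0 0 = Affine x' y'" using ec by blast
    have "(x - 0) * (x' - 0) = 3 * 0\<^sup>2 + 2 * (p' + q') * 0 + p' * q'"
      by (rule mult_two_torsion[OF s c(1) roots(1)])
    then have "x * x' = p' * q'" by simp
    then have "(p' * q') * (\<sigma> * x' * u\<^sup>2) = (p' * q') * 1" using * by (simp add: mult_ac)
    then have "\<sigma> * x' * u\<^sup>2 = 1" using q0 by (metis mult_cancel_left mult_eq_0_iff)
    moreover have "u \<noteq> 0" using * x0 by auto
    ultimately have "x' = \<sigma> * (1 / u)\<^sup>2" using \<sigma> by (auto simp: field_simps power_divide)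
    moreover have "\<exists>z. (x - - q') * (0 - - q') * (x' - - q') = z\<^sup>2"
      by (rule mult_root_square[OF s c(1) _ roots(3)]) (simp add: on_curve_iff)
    then obtain z where "(x + q') * q' * (x' + q') = z\<^sup>2" by auto
    then have "\<exists>z. x' + q' = z\<^sup>2"
      by (rule square_mult_cancel[where v = "q' * w"]) (use * q0 x0 in \<open>auto simp: power2_eq_square\<close>)
    ultimately show ?thesis using s \<sigma> by (auto simp: two_torsion_def) 
  next
    assume *: "x = \<sigma> * p' * u\<^sup>2 \<and> x + q' = 2 * w\<^sup>2"
    obtain x' y' where s: "Affine x y \<otimes>\<^bsub>E\<^esub> Affine (- p') 0 = Affine x' y'" using ec by blast
    have cp: "on_curve (- p') 0" by (simp add: on_curve_iff)
    obtain z where z: "(x - 0) * (- p' - 0) * (x' - 0) = z\<^sup>2"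
      using mult_root_square[OF s c(1) cp roots(1)] by auto
    then have "x * p' * (- \<sigma> * x') * \<sigma> = z\<^sup>2" using \<sigma>\<sigma> by (auto simp: mult_ac)
    then have "(\<sigma> * x) * p' * (- \<sigma> * x') = z\<^sup>2" by (simp add: mult_ac)
    moreover have "(\<sigma> * x) * p' = (p' * u)\<^sup>2" using * \<sigma> by (auto simp: power2_eq_square)
    moreover have "\<sigma> * x * p' \<noteq> 0" using \<sigma>\<sigma>(3) x0 q0 by simp
    ultimately obtain v where "- \<sigma> * x' = v\<^sup>2" using square_mult_cancel by blast
    then have "x' = (- \<sigma>) * v\<^sup>2" using \<sigma> by auto
    moreover obtain t where "(x - - q') * (- p' - - q') * (x' - - q') = t\<^sup>2"
      using mult_root_square[OF s c(1) cp roots(3)] by auto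
    then have "(x + q') * 2 * (x' + q') = t\<^sup>2" using q0 by simp
    then have "\<exists>z. x' + q' = z\<^sup>2"
      by (rule square_mult_cancel[where v = "2 * w"]) (use * q0 x0 in \<open>auto simp: power2_eq_square\<close>)
    ultimately show ?thesis using s \<sigma>\<sigma>(2) unfolding two_torsion_def by blast
  next
    assume *: "x = \<sigma> * q' * u\<^sup>2 \<and> x + q' = 2 * q' * w\<^sup>2"
    obtain x' y' where s: "Affine x y \<otimes>\<^bsub>E\<^esub> Affine (- q') 0 = Affine x' y'" using ec by blast
    have cq: "on_curve (- q') 0" by (simp add: on_curve_iff)
    obtain z where z: "(x - 0) * (- q' - 0) * (x' - 0) = z\<^sup>2"
      using mult_root_square[OF s c(1) cq roots(1)] by auto
    then have "(\<sigma> * x) * q' * (- \<sigma> * x') = z\<^sup>2" using \<sigma> by (auto simp: mult_ac)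
    moreover have "(\<sigma> * x) * q' = (q' * u)\<^sup>2" using * \<sigma> by (auto simp: power2_eq_square)
    moreover have "\<sigma> * x * q' \<noteq> 0" using \<sigma>\<sigma>(3) x0 q0 by simp
    ultimately obtain v where "- \<sigma> * x' = v\<^sup>2" using square_mult_cancel by blast
    then have x': "x' = (- \<sigma>) * v\<^sup>2" using \<sigma> by auto
    have "(x - - q') * (x' - - q') = 3 * (- q')\<^sup>2 + 2 * (p' + q') * (- q') + p' * q'"
      by (rule mult_two_torsion[OF s c(1) roots(3)])
    then have "(x + q') * (x' + q') = q' * (q' - p')" by (simp add: algebra_simps power2_eq_square)
    moreover have "x + q' = 2 * q' * w\<^sup>2" using * ..
    ultimately have "(2 * q') * (w\<^sup>2 * (x' + q')) = (2 * q') * 1" using q0(3) by (simp only: mult_ac)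
    then have "w\<^sup>2 * (x' + q') = 1" using q0 by (metis mult_cancel_left mult_eq_0_iff zero_neq_numeral)
    then have "x' + q' = (1 / w)\<^sup>2" by (cases "w = 0") (auto simp: power_divide divide_simps mult_ac)
    then show ?thesis using s x' \<sigma>\<sigma>(2) unfolding two_torsion_def by blast
  qed
qed

text \<open>The first alternative covers the translates with y = 0, for which the class of some
  factor is undefined: if P + K is 2-torsion, P itself is in \<open>half_multiples\<close>.\<close>

lemma descent_step:
  assumes "P \<in> ec_points cubic"
  shows "P \<in> half_multiples \<or>
    (\<exists>K\<in>translates. \<exists>R\<in>ec_points cubic. P \<otimes>\<^bsub>E\<^esub> K = R \<otimes>\<^bsub>E\<^esub> R)"
proof (rule disjCI)
  assume no: "\<not> (\<exists>K\<in>translates. \<exists>R\<in>ec_points cubic. P \<otimes>\<^bsub>E\<^esub> K = R \<otimes>\<^bsub>E\<^esub> R)"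
  have th: "T \<in> half_multiples" if "T \<in> two_torsion" for T using that two_torsion_half_multiples by blast
  show "P \<in> half_multiples"
  proof (cases "P \<in> two_torsion")
    case False
    then obtain x y where P: "P = Affine x y" "on_curve x y" "y \<noteq> 0"
      using assms two_torsion_if_y_0 by (cases P) (auto simp: two_torsion_def)
    obtain T x' y' \<sigma> u w where T: "T \<in> two_torsion" and s: "P \<otimes>\<^bsub>E\<^esub> T = Affine x' y'"
      and \<sigma>: "\<sigma> \<in> {1, -1}" and x': "x' = \<sigma> * u\<^sup>2" "x' + q' = w\<^sup>2"
      using two_torsion_translate[OF P(2,3)] P(1) by blast
    have TE: "T \<in> carrier E" using T two_torsion_iff by simp
    have PT: "P \<otimes>\<^bsub>E\<^esub> T \<in> carrier E" using assms TE E.m_closed by simp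
    then have c': "on_curve x' y'" using s by simp
    show ?thesis
    proof (cases "y' = 0")
      case True
      then have "P \<otimes>\<^bsub>E\<^esub> T \<in> half_multiples" using s c' two_torsion_if_y_0 th by simp
      then show ?thesis using half_multiples_cancel assms T th by blast
    next
      case False
      then have x0: "x' \<noteq> 0" "x' + q' \<noteq> 0" using c' by (auto simp: on_curve_iff)
      show ?thesis
      proof (cases "\<sigma> = 1")
        case True
        then obtain R where "R \<in> ec_points cubic" "R \<otimes>\<^bsub>E\<^esub> R = Affine x' y'"
          using halving[OF c'] x' x0 by auto
        then show ?thesis using no T s unfolding translates_def by (metis UnI1)
      next
        case False
        \<comment> \<open>\<open>x'\<close> and \<open>gx\<close> are both minus a square, and
          \<open>x' + q'\<close> and \<open>gx + q'\<close> are both squares, so adding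
          \<open>gen\<close> makes the class trivial.\<close>
        then have xu: "x' = - u\<^sup>2" using \<sigma> x' by auto
        have assoc: "P \<otimes>\<^bsub>E\<^esub> (T \<otimes>\<^bsub>E\<^esub> gen) = Affine x' y' \<otimes>\<^bsub>E\<^esub> gen"
          using assms TE s by (metis E.m_assoc carrier_E gen_in)
        have tg: "T \<otimes>\<^bsub>E\<^esub> gen \<in> half_multiples"
          using subgroup.m_closed[OF subgroup_half_multiples] th T gen_half_multiple by blast
        have P'': "P \<otimes>\<^bsub>E\<^esub> (T \<otimes>\<^bsub>E\<^esub> gen) \<in> carrier E"
          using assms TE E.m_closed gen_in by simp
        show ?thesis
        proof (cases "P \<otimes>\<^bsub>E\<^esub> (T \<otimes>\<^bsub>E\<^esub> gen) \<in> two_torsion")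
          case True
          then show ?thesis using half_multiples_cancel assms tg th by blast
        next
          case False
          then obtain x2 y2 where s2: "P \<otimes>\<^bsub>E\<^esub> (T \<otimes>\<^bsub>E\<^esub> gen) = Affine x2 y2" "on_curve x2 y2" "y2 \<noteq> 0"
            using P'' two_torsion_if_y_0
            by (cases "P \<otimes>\<^bsub>E\<^esub> (T \<otimes>\<^bsub>E\<^esub> gen)") (auto simp: two_torsion_def)
          then have x20: "x2 \<noteq> 0" "x2 + q' \<noteq> 0" by (auto simp: on_curve_iff)
          have s3: "Affine x' y' \<otimes>\<^bsub>E\<^esub> Affine gx gy = Affine x2 y2"
            using s2(1) assoc by (simp add: gen_def)
          obtain z where "(x' - 0) * (gx - 0) * (x2 - 0) = z\<^sup>2"
            using mult_root_square[OF s3 c' on_curve_gen roots(1)] by auto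
          then have "x' * gx * x2 = z\<^sup>2" by simp
          moreover have "x' * gx = (u * (of_int (int q + a + b) / of_int c))\<^sup>2"
            unfolding xu gx_def by (simp only: power_mult_distrib minus_mult_minus)
          ultimately have "\<exists>u. x2 = u\<^sup>2"
            by (rule square_mult_cancel) (use x0 gen_signs in simp)
          then obtain u2 where u2: "x2 = u2\<^sup>2" by blast
          obtain t where "(x' - - q') * (gx - - q') * (x2 - - q') = t\<^sup>2"
            using mult_root_square[OF s3 c' on_curve_gen roots(3)] by auto
          then have "(x' + q') * (gx + q') * (x2 + q') = t\<^sup>2" by simp
          moreover have "(x' + q') * (gx + q') = (w * (of_int (a - b) / of_int c))\<^sup>2"
            unfolding x'(2) gx_q by (simp only: power_mult_distrib)
          ultimately have "\<exists>w. x2 + q' = w\<^sup>2"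
            by (rule square_mult_cancel) (use x0 gen_signs in simp)
          then obtain R where "R \<in> ec_points cubic" "R \<otimes>\<^bsub>E\<^esub> R = Affine x2 y2"
            using halving[OF s2(2) u2] x20 by blast
          then show ?thesis using no T s2(1) unfolding translates_def by (metis UnI2 imageI)
        qed
      qed
    qed
  qed (use th in blast)
qed

end

section \<open>A point of infinite order\<close>

context twin_primes begin

lemma double_squares:
  assumes "R \<in> ec_points cubic" "R \<otimes>\<^bsub>E\<^esub> R = Affine x y"
  shows "\<exists>w. x = w\<^sup>2" "\<exists>w. x + p' = w\<^sup>2" "\<exists>w. x + q' = w\<^sup>2"
proof -
  obtain x1 y1 where R: "R = Affine x1 y1" using assms(2) by (cases R) (auto simp: mult_E)
  then have R': "Affine x1 y1 \<otimes>\<^bsub>E\<^esub> Affine x1 y1 = Affine x y" "on_curve x1 y1" using assms by auto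
  show "\<exists>w. x = w\<^sup>2" "\<exists>w. x + p' = w\<^sup>2" "\<exists>w. x + q' = w\<^sup>2"
    using double_root_square[OF R' roots(1)] double_root_square[OF R' roots(2)]
      double_root_square[OF R' roots(3)] by auto
qed

lemma not_rat_squares: "w\<^sup>2 \<noteq> p'" "w\<^sup>2 \<noteq> 2 * p'" "w\<^sup>2 \<noteq> 2 * q'"
proof -
  have "\<not> int p dvd 1" using prime_int_p not_prime_unit by blast
  then show "w\<^sup>2 \<noteq> p'" using prime_times_not_rat_square[OF prime_int_p, of 1 w] by simp
  show "w\<^sup>2 \<noteq> 2 * p'" "w\<^sup>2 \<noteq> 2 * q'"
    using prime_times_not_rat_square[OF prime_int_p, of 2 w]
      prime_times_not_rat_square[OF prime_int_q, of 2 w] not_q_dvd_small by (simp_all add: mult.commute)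
qed

text \<open>There is no rational point of order 4: a double has three square factors, but 0 + p is
  not a square and the other two abscissas are negative.\<close>

lemma two_torsion_not_double:
  assumes "T \<in> two_torsion" "T \<noteq> Infinity" "R \<in> ec_points cubic"
  shows "R \<otimes>\<^bsub>E\<^esub> R \<noteq> T"
proof
  assume *: "R \<otimes>\<^bsub>E\<^esub> R = T"
  consider "T = Affine 0 0" | "T = Affine (- p') 0" | "T = Affine (- q') 0"
    using assms(1,2) by (auto simp: two_torsion_def)
  then show False
  proof cases
    case 1
    then show False using double_squares(2)[OF assms(3), of 0 0] * not_rat_squares(1) by (metis add_0)
  next
    case 2
    then obtain w where "- p' = w\<^sup>2" using double_squares(1)[OF assms(3)] * by auto
    then show False using p'_pos zero_le_power2[of w] by linarith
  next
    case 3
    then obtain w where "- q' = w\<^sup>2" using double_squares(1)[OF assms(3)] * by auto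
    then show False using p'_pos q'_eq zero_le_power2[of w] by linarith
  qed
qed

end

context twin_primes_point begin

text \<open>For T = \<open>Infinity\<close> and T = (0,0) the obstruction is the negative abscissa
  of the sum. For the other two points, a square factor at the root would make 2p or 2q a rational
  square.\<close>

lemma gen_translate_not_double:
  assumes T: "T \<in> two_torsion" and R: "R \<in> ec_points cubic"
  shows "R \<otimes>\<^bsub>E\<^esub> R \<noteq> gen \<otimes>\<^bsub>E\<^esub> T"
proof
  assume *: "R \<otimes>\<^bsub>E\<^esub> R = gen \<otimes>\<^bsub>E\<^esub> T"
  have ec: "\<exists>x' y'. gen \<otimes>\<^bsub>E\<^esub> Affine e 0 = Affine x' y'" for e
    using gen_signs(4) by (simp add: mult_E gen_def Let_def)
  consider "T = Infinity" | "T = Affine 0 0" | "T = Affine (- p') 0" | "T = Affine (- q') 0"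
    using T by (auto simp: two_torsion_def)
  then show False
  proof cases
    case 1
    then have "R \<otimes>\<^bsub>E\<^esub> R = Affine gx gy" using * by (simp add: mult_E gen_def)
    then obtain w where "gx = w\<^sup>2" using double_squares(1)[OF R] by blast
    then show False using gen_signs(1) zero_le_power2[of w] by linarith
  next
    case 2
    then obtain x' y' where s: "gen \<otimes>\<^bsub>E\<^esub> Affine 0 0 = Affine x' y'" using ec by blast
    then obtain w where w: "x' = w\<^sup>2" using double_squares(1)[OF R] * 2 by auto
    have "gx * x' = p' * q'"
      using mult_two_torsion[OF s[unfolded gen_def] on_curve_gen roots(1)] by simp
    then have "gx * x' > 0" using p'_pos q'_eq by simp
    then show False using gen_signs(1) w zero_le_power2[of w] by (simp add: zero_less_mult_iff)
  next
    case 3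
    then obtain x' y' where s: "gen \<otimes>\<^bsub>E\<^esub> Affine (- p') 0 = Affine x' y'" using ec by blast
    then obtain w where w: "x' + p' = w\<^sup>2" using double_squares(2)[OF R] * 3 by auto
    have "(gx + p') * (x' + p') = - (p' * (q' - p'))"
      using mult_two_torsion[OF s[unfolded gen_def] on_curve_gen roots(2)]
      by (simp add: algebra_simps power2_eq_square)
    then have "(of_int (a + b + 2) / of_int c)\<^sup>2 * w\<^sup>2 = 2 * p'"
      unfolding gx_p w by (simp add: q'_eq)
    then have "((of_int (a + b + 2) / of_int c) * w)\<^sup>2 = 2 * p'" by (simp only: power_mult_distrib)
    then show False using not_rat_squares by blast
  next
    case 4
    then obtain x' y' where s: "gen \<otimes>\<^bsub>E\<^esub> Affine (- q') 0 = Affine x' y'" using ec by blast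
    then obtain w where w: "x' + q' = w\<^sup>2" using double_squares(3)[OF R] * 4 by auto
    have "(gx + q') * (x' + q') = q' * (q' - p')"
      using mult_two_torsion[OF s[unfolded gen_def] on_curve_gen roots(3)]
      by (simp add: algebra_simps power2_eq_square)
    then have "(of_int (a - b) / of_int c)\<^sup>2 * w\<^sup>2 = 2 * q'"
      unfolding gx_q w by (simp add: q'_eq)
    then have "((of_int (a - b) / of_int c) * w)\<^sup>2 = 2 * q'" by (simp only: power_mult_distrib)
    then show False using not_rat_squares by blast
  qed
qed

text \<open>Written additively: an odd \<open>n\<close> would make \<open>gen\<close> a double. If n
  = 2m, then T = m gen is nonzero 2-torsion by induction; for even m it is a double, for odd m gen +
  T is one, and both are excluded.\<close>

lemma gen_pow_nonzero: "n > 0 \<Longrightarrow> gen [^]\<^bsub>E\<^esub> (n::nat) \<noteq> \<one>\<^bsub>E\<^esub>"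
proof (induction n rule: less_induct)
  case (less n)
  have g: "gen \<in> carrier E" by simp
  show ?case
  proof
    assume n1: "gen [^]\<^bsub>E\<^esub> n = \<one>\<^bsub>E\<^esub>"
    show False
    proof (cases "even n")
      case False
      then obtain k where k: "n = Suc (k + k)" by (metis oddE Suc_eq_plus1 mult_2)
      define X where "X = gen [^]\<^bsub>E\<^esub> k"
      have X: "X \<in> carrier E" using g unfolding X_def by (rule E.nat_pow_closed)
      have "X \<otimes>\<^bsub>E\<^esub> X \<otimes>\<^bsub>E\<^esub> gen = \<one>\<^bsub>E\<^esub>"
        using n1 unfolding k X_def by (simp add: E.nat_pow_mult[OF g])
      then have "gen = inv\<^bsub>E\<^esub> X \<otimes>\<^bsub>E\<^esub> inv\<^bsub>E\<^esub> X"
        using X g by (metis E.inv_equality E.inv_mult_group E.m_comm E.m_closed)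
      then have "inv\<^bsub>E\<^esub> X \<otimes>\<^bsub>E\<^esub> inv\<^bsub>E\<^esub> X = gen \<otimes>\<^bsub>E\<^esub> Infinity"
        by (simp add: mult_E)
      then show False using gen_translate_not_double[of Infinity] E.inv_closed[OF X]
        by (auto simp: two_torsion_def)
    next
      case True
      then obtain m where m: "n = m + m" by (metis evenE mult_2)
      define T where "T = gen [^]\<^bsub>E\<^esub> m"
      have T: "T \<in> carrier E" using g unfolding T_def by (rule E.nat_pow_closed)
      have TT: "T \<otimes>\<^bsub>E\<^esub> T = \<one>\<^bsub>E\<^esub>"
        using n1 unfolding m T_def by (simp add: E.nat_pow_mult[OF g])
      then have T2: "T \<in> two_torsion" using T two_torsion_iff by simp
      have T1: "T \<noteq> Infinity" using less.IH[of m] less.prems m unfolding T_def by auto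
      show False
      proof (cases "even m")
        case True
        then obtain k where k: "m = k + k" by (metis evenE mult_2)
        have "T = gen [^]\<^bsub>E\<^esub> k \<otimes>\<^bsub>E\<^esub> gen [^]\<^bsub>E\<^esub> k"
          unfolding T_def k by (simp add: E.nat_pow_mult[OF g])
        then show False using two_torsion_not_double[OF T2 T1] E.nat_pow_closed[OF g, of k] carrier_E by metis
      next
        case False
        then obtain k where k: "m = Suc (k + k)" by (metis oddE Suc_eq_plus1 mult_2)
        define X where "X = gen [^]\<^bsub>E\<^esub> k"
        have X: "X \<in> carrier E" using g unfolding X_def by (rule E.nat_pow_closed)
        have TX: "T = X \<otimes>\<^bsub>E\<^esub> X \<otimes>\<^bsub>E\<^esub> gen"
          unfolding T_def k X_def by (simp add: E.nat_pow_mult[OF g])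
        have "(X \<otimes>\<^bsub>E\<^esub> X) \<otimes>\<^bsub>E\<^esub> (gen \<otimes>\<^bsub>E\<^esub> T) = \<one>\<^bsub>E\<^esub>"
          using TT TX X T g by (metis E.m_assoc E.m_closed)
        then have "gen \<otimes>\<^bsub>E\<^esub> T = inv\<^bsub>E\<^esub> X \<otimes>\<^bsub>E\<^esub> inv\<^bsub>E\<^esub> X"
          using X g T by (metis E.inv_equality E.inv_mult_group E.m_comm E.m_closed)
        then show False using gen_translate_not_double[OF T2] E.inv_closed[OF X] carrier_E by metis
      qed
    qed
  qed
qed

lemma gen_int_pow_eq_one: "gen [^]\<^bsub>E\<^esub> (n::int) = \<one>\<^bsub>E\<^esub> \<Longrightarrow> n = 0"
proof (rule ccontr)
  assume n: "gen [^]\<^bsub>E\<^esub> n = \<one>\<^bsub>E\<^esub>" "n \<noteq> 0"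
  have "gen [^]\<^bsub>E\<^esub> nat \<bar>n\<bar> = \<one>\<^bsub>E\<^esub>"
  proof (cases "n \<ge> 0")
    case True
    then show ?thesis using n(1) int_pow_int[of E gen "nat n"] by simp
  next
    case False
    have "gen [^]\<^bsub>E\<^esub> (- n) = \<one>\<^bsub>E\<^esub>" using n(1) E.int_pow_neg[of gen n] E.inv_one by simp
    then show ?thesis using False int_pow_int[of E gen "nat (- n)"] by simp
  qed
  then show False using gen_pow_nonzero[of "nat \<bar>n\<bar>"] n(2) by simp
qed

end

section \<open>Heights\<close>

definition height :: "rat \<Rightarrow> int" where
  "height x = max \<bar>fst (quotient_of x)\<bar> (snd (quotient_of x))"

lemma height_fraction:
  assumes "coprime r s" "s > 0" shows "height (of_int r / of_int s) = max \<bar>r\<bar> s"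
  using assms by (simp add: height_def Fract_of_int_quotient[symmetric] quotient_of_Fract Rat.normalize_def)

lemma fraction_lowest_terms:
  obtains r s where "x = of_int r / of_int s" "coprime r s" "s > 0" "height x = max \<bar>r\<bar> s"
proof -
  obtain r s where "quotient_of x = (r, s)" by (cases "quotient_of x")
  then show thesis
    by (intro that[of r s])
       (use quotient_of_div quotient_of_denom_pos quotient_of_coprime in \<open>auto simp: height_def\<close>)
qed

lemma height_pos: "height x \<ge> 1"
  using fraction_lowest_terms[of x] by (metis max.cobounded2 int_one_le_iff_zero_less order_trans)

lemma fraction_multiple_of_lowest:
  fixes A B r s :: int
  assumes "of_int A / of_int B = (of_int r / of_int s :: rat)" "B \<noteq> 0" "coprime r s" "s > 0"
  shows "\<exists>k. k \<noteq> 0 \<and> A = k * r \<and> B = k * s"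
proof -
  have "(of_int (A * s) :: rat) = of_int (r * B)" using assms by (simp add: field_simps)
  then have eq: "A * s = r * B" by (simp only: of_int_eq_iff)
  then have "s dvd r * B" by (metis dvd_triv_right)
  then have "s dvd B" using assms(3) by (metis coprime_commute coprime_dvd_mult_right_iff)
  then obtain k where k: "B = s * k" by auto
  then have "s * A = s * (k * r)" using eq by (simp add: mult_ac)
  then have "A = k * r" using assms(4) by simp
  then show ?thesis using k assms(2) by (auto simp: mult.commute)
qed

lemma height_fraction_le:
  assumes "B \<noteq> 0" shows "height (of_int A / of_int B) \<le> max \<bar>A\<bar> \<bar>B\<bar>"
proof -
  obtain r s where rs: "of_int A / of_int B = (of_int r / of_int s :: rat)" "coprime r s" "s > 0"
    "height (of_int A / of_int B) = max \<bar>r\<bar> s" using fraction_lowest_terms by metis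
  obtain k where k: "k \<noteq> 0" "A = k * r" "B = k * s"
    using fraction_multiple_of_lowest[OF rs(1) assms rs(2,3)] by blast
  have "\<bar>k\<bar> \<ge> 1" using k(1) by linarith
  then have "\<bar>r\<bar> \<le> \<bar>k\<bar> * \<bar>r\<bar>" "s \<le> \<bar>k\<bar> * \<bar>s\<bar>"
    using rs(3) by (simp_all add: mult_le_cancel_right1)
  then have "max \<bar>r\<bar> s \<le> max \<bar>A\<bar> \<bar>B\<bar>"
    unfolding k abs_mult using rs(3) by (intro max.mono) simp_all
  then show ?thesis using rs(4) by simp
qed

lemma finite_height_le: "finite {x. height x \<le> N}"
proof (rule finite_subset)
  show "{x. height x \<le> N} \<subseteq> (\<lambda>(r, s). of_int r / of_int s) ` ({- N..N} \<times> {0..N})"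
  proof
    fix x assume "x \<in> {x. height x \<le> N}"
    moreover obtain r s where "x = of_int r / of_int s" "s > 0" "height x = max \<bar>r\<bar> s"
      using fraction_lowest_terms by metis
    ultimately show "x \<in> (\<lambda>(r, s). of_int r / of_int s) ` ({- N..N} \<times> {0..N})"
      by (intro image_eqI[of _ _ "(r, s)"]) auto
  qed
qed simp

text \<open>On y^2 = x(x^2 + A x + B) with x = r/s, the two forms are numerator and denominator of
  the abscissa of the double. Euclidean elimination lowers the power of \<open>r\<close> step by
  step; the powers of \<open>s\<close> drop out because \<open>d\<close> is coprime to
  \<open>s\<close>.\<close>

lemma doubling_common_divisor:
  fixes r s A B d :: int
  assumes rs: "coprime r s" and dF: "d dvd (r\<^sup>2 - B * s\<^sup>2)\<^sup>2"
    and dK: "d dvd 4 * r * s * (r\<^sup>2 + A * r * s + B * s\<^sup>2)"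
  shows "d dvd 4 * (A\<^sup>2 - 4 * B) * B^4"
proof -
  define F where "F = (r\<^sup>2 - B * s\<^sup>2)\<^sup>2"
  define D where "D = 4 * (A\<^sup>2 - 4 * B)"
  have dF: "d dvd F" using dF by (simp add: F_def)
  have "coprime (r^4) s" using rs by simp
  moreover have "F = r^4 + (B\<^sup>2 * s^3 - 2 * B * r\<^sup>2 * s) * s"
    by (simp add: F_def algebra_simps power2_eq_square power3_eq_cube power4_eq_xxxx)
  ultimately have "coprime F s"
    by (metis add.commute coprime_commute coprime_iff_gcd_eq_1 gcd_add_mult)
  then have ds: "coprime d (s^k)" for k
    using dF by (metis coprime_divisors coprime_power_right_iff dvd_refl)
  have "D * r^3 * s^3 = 4 * r * s * F - (r\<^sup>2 - A * r * s + B * s\<^sup>2) * (4 * r * s * (r\<^sup>2 + A * r * s + B * s\<^sup>2))"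
    by (simp add: F_def D_def algebra_simps power2_eq_square power3_eq_cube)
  then have "d dvd D * r^3 * s^3" using dF dK by (metis dvd_diff dvd_mult)
  then have 1: "d dvd D * r^3" by (simp only: coprime_dvd_mult_left_iff[OF ds])
  have "D * B\<^sup>2 * r * s^4 = D * r * F - (r\<^sup>2 - 2 * B * s\<^sup>2) * (D * r^3)"
    by (simp add: F_def algebra_simps power2_eq_square power3_eq_cube power4_eq_xxxx)
  then have "d dvd D * B\<^sup>2 * r * s^4" using dF 1 by (metis dvd_diff dvd_mult)
  then have 2: "d dvd D * B\<^sup>2 * r" by (simp only: coprime_dvd_mult_left_iff[OF ds])
  have "D * B^4 * s^4 = D * B\<^sup>2 * F - (r^3 - 2 * B * r * s\<^sup>2) * (D * B\<^sup>2 * r)"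
    by (simp add: F_def algebra_simps power2_eq_square power3_eq_cube power4_eq_xxxx)
  then have "d dvd D * B^4 * s^4" using dF 2 by (metis dvd_diff dvd_mult)
  then show ?thesis unfolding D_def by (simp only: coprime_dvd_mult_left_iff[OF ds])
qed


text \<open>If r^2 and B s^2 differ by a factor of at least 2, the first form is large by itself.
  Otherwise \<open>r\<close> and \<open>s\<close> are of comparable size, and an elimination
  identity bounds (rs)^3 by both forms.\<close>

lemma doubling_size:
  fixes r s A B :: int
  assumes A: "A \<ge> 0" and B: "B \<ge> 1" and D: "A\<^sup>2 - 4 * B \<ge> 1" and s: "s > 0"
  shows "(max \<bar>r\<bar> s)^4 \<le> 8 * B^3 * (5 + A + B) *
    max \<bar>(r\<^sup>2 - B * s\<^sup>2)\<^sup>2\<bar> \<bar>4 * r * s * (r\<^sup>2 + A * r * s + B * s\<^sup>2)\<bar>"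
proof -
  define H where "H = max \<bar>r\<bar> s"
  define F where "F = (r\<^sup>2 - B * s\<^sup>2)\<^sup>2"
  define K where "K = 4 * r * s * (r\<^sup>2 + A * r * s + B * s\<^sup>2)"
  define M where "M = max \<bar>F\<bar> \<bar>K\<bar>"
  define C where "C = 8 * B^3 * (5 + A + B)"
  have H: "\<bar>r\<bar> \<le> H" "s \<le> H" "H > 0" using s by (auto simp: H_def)
  have M: "F \<le> M" "\<bar>K\<bar> \<le> M" "F \<ge> 0" "M \<ge> 0" by (auto simp: M_def F_def)
  have B3: "B^3 \<ge> 1" using B by (simp add: one_le_power)
  then have "8 * B^3 * (5 + A + B) \<ge> 8 * 1 * 6"
    using A B by (intro mult_mono) auto
  then have C4: "C \<ge> 4" by (simp add: C_def)
  have H2: "H\<^sup>2 = max (r\<^sup>2) (s\<^sup>2)"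
    unfolding H_def using s by (auto simp: max_def abs_le_square_iff[symmetric])
  have rs2: "r\<^sup>2 \<le> H\<^sup>2" "s\<^sup>2 \<le> H\<^sup>2" unfolding H2 by simp_all
  have s2B: "s\<^sup>2 \<le> B * s\<^sup>2" using B by (simp add: mult_le_cancel_right1)
  have H4: "H^4 \<le> 4 * F" if "H\<^sup>2 \<le> 2 * \<bar>r\<^sup>2 - B * s\<^sup>2\<bar>"
  proof -
    have "(H\<^sup>2)\<^sup>2 \<le> (2 * \<bar>r\<^sup>2 - B * s\<^sup>2\<bar>)\<^sup>2" using that by (intro power_mono) auto
    then show ?thesis unfolding F_def by (simp add: power_mult_distrib flip: power_mult)
  qed
  have small: "H^4 \<le> C * M" if "H\<^sup>2 \<le> 2 * \<bar>r\<^sup>2 - B * s\<^sup>2\<bar>"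
  proof -
    have "4 * F \<le> C * M" using C4 M by (intro mult_mono) auto
    then show ?thesis using H4[OF that] by linarith
  qed
  have far: "u \<le> 2 * \<bar>u - t\<bar> \<and> v \<le> 2 * \<bar>u - t\<bar>"
    if "2 * t \<le> u \<or> 2 * u \<le> t" "v \<le> t" "0 \<le> v" "0 \<le> u" for t u v :: int
    using that by arith
  have near: "(u \<le> 2 * t \<and> v \<le> 2 * t) \<and> (u \<le> 2 * u \<and> v \<le> 2 * u)"
    if "u < 2 * t" "t < 2 * u" "v \<le> t" for t u v :: int
    using that by arith
  consider "2 * (B * s\<^sup>2) \<le> r\<^sup>2" | "2 * r\<^sup>2 \<le> B * s\<^sup>2" | "r\<^sup>2 < 2 * (B * s\<^sup>2)" "B * s\<^sup>2 < 2 * r\<^sup>2" by linarith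
  then have "H^4 \<le> C * M"
  proof cases
    case 1
    then have "H\<^sup>2 \<le> 2 * \<bar>r\<^sup>2 - B * s\<^sup>2\<bar>" unfolding H2 max.bounded_iff
      using far[OF _ s2B] zero_le_power2[of s] zero_le_power2[of r] by blast
    then show ?thesis by (rule small)
  next
    case 2
    then have "H\<^sup>2 \<le> 2 * \<bar>r\<^sup>2 - B * s\<^sup>2\<bar>" unfolding H2 max.bounded_iff
      using far[OF _ s2B] zero_le_power2[of s] zero_le_power2[of r] by blast
    then show ?thesis by (rule small)
  next
    case 3
    define w where "w = \<bar>r * s\<bar>"
    have w: "w \<ge> 0" "w\<^sup>2 = r\<^sup>2 * s\<^sup>2" by (simp_all add: w_def power_mult_distrib)
    have "H\<^sup>2 \<le> 2 * (B * s\<^sup>2)" "H\<^sup>2 \<le> 2 * r\<^sup>2" unfolding H2 max.bounded_iff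
      using near[OF 3 s2B] by blast+
    then have "H\<^sup>2 * H\<^sup>2 \<le> 2 * (B * s\<^sup>2) * (2 * r\<^sup>2)" using B by (intro mult_mono) auto
    \<comment> \<open>The extra factor \<open>B\<close> makes the bound a perfect square, so that a
      root can be taken.\<close>
    also have "\<dots> \<le> B * (4 * B * (r\<^sup>2 * s\<^sup>2))"
      using mult_right_mono[OF B, of "r\<^sup>2 * s\<^sup>2"] B by (simp add: mult_ac)
    also have "\<dots> = (2 * B * w)\<^sup>2"
      unfolding w(2)[symmetric] by (simp add: power2_eq_square mult_ac)
    finally have "(H\<^sup>2)\<^sup>2 \<le> (2 * B * w)\<^sup>2" by (simp add: power2_eq_square)
    then have Hw: "H\<^sup>2 \<le> 2 * B * w" by (rule power2_le_imp_le) (use B w(1) in simp)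
    define g where "g = r\<^sup>2 - A * r * s + B * s\<^sup>2"
    have wH: "w \<le> H\<^sup>2" unfolding w_def abs_mult power2_eq_square using H s by (intro mult_mono) auto
    have "\<bar>u - v + t\<bar> \<le> u + \<bar>v\<bar> + t" if "0 \<le> u" "0 \<le> t" for u v t :: int
      using that by arith
    then have "\<bar>g\<bar> \<le> r\<^sup>2 + \<bar>A * r * s\<bar> + B * s\<^sup>2" unfolding g_def using B by simp
    also have "\<bar>A * r * s\<bar> = A * w" using A by (simp add: w_def abs_mult mult.assoc)
    also have "r\<^sup>2 + A * w + B * s\<^sup>2 \<le> H\<^sup>2 + A * H\<^sup>2 + B * H\<^sup>2"
      using rs2 wH A B by (intro add_mono mult_left_mono) auto
    finally have g: "\<bar>g\<bar> \<le> (1 + A + B) * H\<^sup>2" by (simp add: algebra_simps)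
    \<comment> \<open>This is the first identity of \<open>doubling_common_divisor\<close> divided
      by s^0 = 1, now read as a size estimate.\<close>
    have "4 * (A\<^sup>2 - 4 * B) * (r * s)^3 = 4 * (r * s) * F - g * K"
      by (simp add: F_def K_def g_def algebra_simps power2_eq_square power3_eq_cube)
    moreover have "\<bar>4 * (A\<^sup>2 - 4 * B) * (r * s)^3\<bar> = 4 * (A\<^sup>2 - 4 * B) * w^3"
      using D by (simp add: abs_mult power_abs w_def)
    ultimately have "4 * (A\<^sup>2 - 4 * B) * w^3 = \<bar>4 * (r * s) * F - g * K\<bar>" by metis
    also have "\<dots> \<le> 4 * w * F + \<bar>g\<bar> * \<bar>K\<bar>"
      using abs_triangle_ineq4[of "4 * (r * s) * F" "g * K"] M(3) by (simp add: abs_mult w_def)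
    also have "\<dots> \<le> 4 * H\<^sup>2 * M + (1 + A + B) * H\<^sup>2 * M"
      using wH g M w(1) A B by (intro add_mono mult_mono) auto
    finally have 1: "4 * (A\<^sup>2 - 4 * B) * w^3 \<le> (5 + A + B) * H\<^sup>2 * M" by (simp add: algebra_simps)
    have "1 * w^3 \<le> 4 * (A\<^sup>2 - 4 * B) * w^3" using D w(1) by (intro mult_right_mono) auto
    with 1 have 2: "w^3 \<le> (5 + A + B) * H\<^sup>2 * M" by simp
    have "H\<^sup>2 * H^4 = (H\<^sup>2)^3" by (simp flip: power_mult power_add)
    also have "\<dots> \<le> (2 * B * w)^3" using Hw by (intro power_mono) auto
    also have "\<dots> = 8 * B^3 * w^3" by (simp add: power_mult_distrib)
    also have "\<dots> \<le> 8 * B^3 * ((5 + A + B) * H\<^sup>2 * M)" using 2 B by (intro mult_left_mono) auto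
    also have "\<dots> = H\<^sup>2 * (C * M)" by (simp add: C_def mult_ac)
    finally have "H\<^sup>2 * H^4 \<le> H\<^sup>2 * (C * M)" .
    then show ?thesis by (rule mult_left_le_imp_le) (use H(3) in simp)
  qed
  then show ?thesis unfolding H_def C_def M_def F_def K_def .
qed

text \<open>The value 1 at \<open>Infinity\<close> is the minimum of \<open>height\<close>, so that
  heights are always at least 1.\<close>

fun point_height :: "rat point \<Rightarrow> int" where
  "point_height Infinity = 1"
| "point_height (Affine x y) = height x"

lemma point_height_pos: "point_height P \<ge> 1"
  by (cases P) (simp_all add: height_pos)

context twin_primes begin

lemma finite_point_height_le: "finite {P \<in> ec_points cubic. point_height P \<le> N}"
proof (rule finite_subset)
  show "{P \<in> ec_points cubic. point_height P \<le> N} \<subseteq>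
      insert Infinity (\<Union>x\<in>{x. height x \<le> N}. Affine x ` {y. y\<^sup>2 = x * (x + p') * (x + q')})"
  proof
    fix P assume "P \<in> {P \<in> ec_points cubic. point_height P \<le> N}"
    then show "P \<in> insert Infinity (\<Union>x\<in>{x. height x \<le> N}. Affine x ` {y. y\<^sup>2 = x * (x + p') * (x + q')})"
      by (cases P) (auto simp: on_curve_iff)
  qed
  have "finite {y. y\<^sup>2 = t}" for t :: rat
  proof (cases "\<exists>z. z\<^sup>2 = t")
    case True
    then obtain z where "z\<^sup>2 = t" by blast
    then have "{y. y\<^sup>2 = t} \<subseteq> {z, - z}" by (auto simp: power2_eq_iff)
    then show ?thesis using finite_subset by blast
  qed simp
  then show "finite (insert Infinity (\<Union>x\<in>{x. height x \<le> N}. Affine x ` {y. y\<^sup>2 = x * (x + p') * (x + q')}))"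
    using finite_height_le by blast
qed

lemma double_x:
  assumes m: "Affine x y \<otimes>\<^bsub>E\<^esub> Affine x y = Affine x2 y2" and c: "on_curve x y"
  shows "4 * x * (x + p') * (x + q') * x2 = (x\<^sup>2 - p' * q')\<^sup>2" "y \<noteq> 0"
proof -
  show "y \<noteq> 0" using m by (auto simp: mult_E)
  obtain l where l: "is_slope l x y x y" "x2 = l\<^sup>2 - (p' + q') - x - x"
    using mult_eq_AffineE m c by metis
  have "l * (2 * y) = 3 * x\<^sup>2 + 2 * (p' + q') * x + p' * q'"
    using l(1) unfolding is_slope_def by (simp add: algebra_simps power2_eq_square)
  moreover have "y\<^sup>2 = x * (x + p') * (x + q')" using c by (simp add: on_curve_iff)
  ultimately show "4 * x * (x + p') * (x + q') * x2 = (x\<^sup>2 - p' * q')\<^sup>2" using l(2) by algebra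
qed

text \<open>The unreduced fraction for the abscissa of the double is large by
  \<open>doubling_size\<close>, and the factor lost in reducing it divides 16 B^4.\<close>

lemma height_double:
  "\<exists>C. \<forall>R\<in>ec_points cubic. point_height R ^ 4 \<le> C * point_height (R \<otimes>\<^bsub>E\<^esub> R)"
proof -
  define A where "A = int p + int q"
  define B where "B = int p * int q"
  have AB: "A \<ge> 0" "B \<ge> 1" "A\<^sup>2 - 4 * B = 4"
    using p_ge_3 mult_mono[of 1 "int p" 1 "int q"] q_eq
    by (simp_all add: A_def B_def int_q algebra_simps power2_eq_square)
  define C where "C = 8 * B^3 * (5 + A + B) * (16 * B^4)"
  \<comment> \<open>The entry q^4 serves the 2-torsion points: their height is at most q, while
    their double has height 1.\<close>
  define C' where "C' = max C (int q ^ 4)"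
  have "point_height R ^ 4 \<le> C' * point_height (R \<otimes>\<^bsub>E\<^esub> R)" if R: "R \<in> ec_points cubic" for R
  proof (cases "R \<otimes>\<^bsub>E\<^esub> R")
    case Infinity
    then have "R \<in> two_torsion" using R two_torsion_iff by simp
    moreover have height_neg: "height (- of_nat n) = max (int n) 1" for n
      using height_fraction[of "- int n" 1] by simp
    have "height 0 \<le> int q" "height (- p') \<le> int q" "height (- q') \<le> int q"
      using p_ge_3 int_q height_neg[of 0] height_neg[of p] height_neg[of q] by simp_all
    ultimately have "point_height R \<le> int q"
      using p_ge_3 int_q unfolding two_torsion_def by auto
    then have "point_height R ^ 4 \<le> int q ^ 4" using point_height_pos[of R] by (intro power_mono) auto
    then show ?thesis using Infinity by (simp add: C'_def)
  next
    case (Affine x2 y2)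
    then obtain x y where Rxy: "R = Affine x y" using R by (cases R) (auto simp: mult_E)
    have xy: "on_curve x y" using R Rxy by simp
    have eq: "4 * x * (x + p') * (x + q') * x2 = (x\<^sup>2 - p' * q')\<^sup>2" and y: "y \<noteq> 0"
      using double_x[OF _ xy] Affine Rxy by blast+
    obtain r s where rs: "x = of_int r / of_int s" "coprime r s" "s > 0" "height x = max \<bar>r\<bar> s"
      using fraction_lowest_terms by metis
    obtain m n where mn: "x2 = of_int m / of_int n" "coprime m n" "n > 0" "height x2 = max \<bar>m\<bar> n"
      using fraction_lowest_terms by metis
    define F where "F = (r\<^sup>2 - B * s\<^sup>2)\<^sup>2"
    define K where "K = 4 * r * s * (r\<^sup>2 + A * r * s + B * s\<^sup>2)"
    have s0: "(of_int s :: rat) \<noteq> 0" using rs(3) by simp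
    have r: "of_int r = x * of_int s" using s0 rs(1) by simp
    have K: "of_int K = 4 * x * (x + p') * (x + q') * of_int s ^ 4"
      unfolding K_def A_def B_def
      by (simp add: r algebra_simps power2_eq_square power4_eq_xxxx)
    have F: "of_int F = (x\<^sup>2 - p' * q')\<^sup>2 * of_int s ^ 4"
      unfolding F_def B_def
      by (simp add: r algebra_simps power2_eq_square power4_eq_xxxx)
    have "x * (x + p') * (x + q') \<noteq> 0" using xy y by (auto simp: on_curve_iff)
    then have "(of_int K :: rat) \<noteq> 0" unfolding K using s0 by simp
    then have K0: "K \<noteq> 0" by simp
    have "of_int F = of_int K * x2" unfolding F K eq[symmetric] by (simp add: mult_ac)
    then have "of_int F / of_int K = (of_int m / of_int n :: rat)"
      using mn(1) \<open>(of_int K :: rat) \<noteq> 0\<close> by (simp add: divide_simps mult_ac)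
    then obtain k where k: "k \<noteq> 0" "F = k * m" "K = k * n"
      using fraction_multiple_of_lowest[OF _ K0 mn(2,3)] by blast
    have "k dvd 4 * (A\<^sup>2 - 4 * B) * B^4"
      by (rule doubling_common_divisor[OF rs(2)]) (use k(2,3) in \<open>simp_all add: F_def K_def\<close>)
    then have "k dvd 16 * B^4" using AB(3) by simp
    then have kB: "\<bar>k\<bar> \<le> 16 * B^4" using AB(2) by (intro zdvd_imp_le) auto
    have M: "max \<bar>F\<bar> \<bar>K\<bar> = \<bar>k\<bar> * height x2"
      unfolding k mn(4) using mn(3) by (simp add: abs_mult max_mult_distrib_left)
    have "height x ^ 4 \<le> 8 * B^3 * (5 + A + B) * max \<bar>F\<bar> \<bar>K\<bar>"
      unfolding rs(4) F_def K_def using AB rs(3) by (intro doubling_size) auto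
    also have "\<dots> \<le> 8 * B^3 * (5 + A + B) * (16 * B^4 * height x2)"
      unfolding M using kB height_pos[of x2] AB by (intro mult_left_mono mult_right_mono) auto
    also have "\<dots> = C * height x2" by (simp add: C_def mult_ac)
    also have "\<dots> \<le> C' * height x2" using height_pos[of x2] by (intro mult_right_mono) (auto simp: C'_def)
    finally show ?thesis using Affine Rxy by simp
  qed
  then show ?thesis by blast
qed

text \<open>After y^2 and y0^2 are replaced by the cubic, the terms x^3 and x0^3 cancel. Hence the
  right side has only degree 2 in \<open>x\<close>, which gives the exponent 2 in
  \<open>height_add\<close>.\<close>

lemma add_x:
  assumes m: "Affine x y \<otimes>\<^bsub>E\<^esub> Affine x0 y0 = Affine x3 y3" and c: "on_curve x y" "on_curve x0 y0"
  shows "x3 * (x - x0)\<^sup>2 = x\<^sup>2 * x0 + x * x0\<^sup>2 + 2 * (p' + q') * x * x0 + p' * q' * (x + x0) - 2 * y * y0"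
proof -
  obtain l where l: "is_slope l x y x0 y0" "x3 = l\<^sup>2 - (p' + q') - x - x0"
    using mult_eq_AffineE m c by metis
  have "y - y0 = l * (x - x0)" using l(1) unfolding is_slope_def by simp
  moreover have "y\<^sup>2 = x * (x + p') * (x + q')" "y0\<^sup>2 = x0 * (x0 + p') * (x0 + q')"
    using c by (simp_all add: on_curve_iff)
  ultimately show ?thesis using l(2) by algebra
qed

lemma height_add:
  assumes K: "K \<in> ec_points cubic"
  shows "\<exists>C. \<forall>P\<in>ec_points cubic. point_height (P \<otimes>\<^bsub>E\<^esub> K) \<le> C * (point_height P)\<^sup>2"
proof (cases K)
  case Infinity
  have "point_height P \<le> 1 * (point_height P)\<^sup>2" for P
    using point_height_pos[of P] by (simp add: power2_eq_square mult_le_cancel_left1)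
  then show ?thesis using Infinity by (auto simp: mult_E intro!: exI[of _ 1])
next
  case (Affine x0 y0)
  then have c0: "on_curve x0 y0" using K by simp
  obtain r0 s0 where rs0: "x0 = of_int r0 / of_int s0" "s0 > 0"
    using fraction_lowest_terms by metis
  obtain Y0 where Y0: "y0 * (of_int s0)\<^sup>2 = of_int Y0"
    using integral_y c0 rs0 by metis
  define A where "A = int p + int q"
  define B where "B = int p * int q"
  have AB: "A \<ge> 0" "B \<ge> 0" by (simp_all add: A_def B_def)
  define C1 where "C1 = \<bar>r0 * s0\<bar> + r0\<^sup>2 + 2 * A * \<bar>r0 * s0\<bar> + B * s0\<^sup>2 + B * \<bar>r0 * s0\<bar>
    + 2 * ((1 + int p) * (1 + int q)) * \<bar>Y0\<bar>"
  define C2 where "C2 = (s0 + \<bar>r0\<bar>)\<^sup>2"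
  define C where "C = C1 + C2 + height x0 + point_height (K \<otimes>\<^bsub>E\<^esub> K)"
  have nonneg: "C1 \<ge> 0" "C2 \<ge> 0" "height x0 \<ge> 1" "point_height (K \<otimes>\<^bsub>E\<^esub> K) \<ge> 1"
    using AB by (simp_all add: C1_def C2_def height_pos point_height_pos)
  have bound: "D \<le> C * (point_height P)\<^sup>2" if "D \<le> C'" "C' \<le> C" "C' \<ge> 0" for D C' P
  proof -
    have "C' * 1 \<le> C * (point_height P)\<^sup>2"
      using that point_height_pos[of P] by (intro mult_mono) (auto simp: one_le_power)
    then show ?thesis using that by simp
  qed
  have "point_height (P \<otimes>\<^bsub>E\<^esub> K) \<le> C * (point_height P)\<^sup>2" if P: "P \<in> ec_points cubic" for P
  proof (cases P)
    case Infinity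
    then have "point_height (P \<otimes>\<^bsub>E\<^esub> K) = height x0" using Affine by (simp add: mult_E)
    then show ?thesis using bound[of "height x0" "height x0" P] nonneg by (simp add: C_def)
  next
    case P: (Affine x y)
    then have c: "on_curve x y" using \<open>P \<in> ec_points cubic\<close> by simp
    show ?thesis
    proof (cases "P \<otimes>\<^bsub>E\<^esub> K")
      case Infinity
      then show ?thesis using bound[of 1 "height x0" P] nonneg by (simp add: C_def)
    next
      case PK: (Affine x3 y3)
      show ?thesis
      proof (cases "x = x0")
        case True
        then have "y\<^sup>2 = y0\<^sup>2" using c c0 by (simp add: on_curve_iff)
        moreover have "y \<noteq> - y0" using PK P Affine True by (auto simp: mult_E)
        ultimately have "P = K" using True P Affine by (auto simp: power2_eq_iff)
        then show ?thesis
          using bound[of "point_height (P \<otimes>\<^bsub>E\<^esub> K)" "point_height (K \<otimes>\<^bsub>E\<^esub> K)" P] nonneg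
          by (simp add: C_def)
      next
        case False
        obtain r s where rs: "x = of_int r / of_int s" "coprime r s" "s > 0" "height x = max \<bar>r\<bar> s"
          using fraction_lowest_terms by metis
        obtain Y where Y: "y * (of_int s)\<^sup>2 = of_int Y" "Y\<^sup>2 = r * (r + int p * s) * (r + int q * s) * s"
          using integral_y c rs by metis
        define H where "H = height x"
        have H: "\<bar>r\<bar> \<le> H" "s \<le> H" "H \<ge> 1" using rs height_pos by (simp_all add: H_def)
        define N where "N = r\<^sup>2 * (r0 * s0) + r * s * r0\<^sup>2 + 2 * A * (r * s) * (r0 * s0) + B * (r * s) * s0\<^sup>2
          + B * (r0 * s0) * s\<^sup>2 - 2 * Y * Y0"
        define D where "D = (r * s0 - r0 * s)\<^sup>2"
        have ne: "(of_int s :: rat) \<noteq> 0" "(of_int s0 :: rat) \<noteq> 0" using rs(3) rs0(2) by simp_all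
        have r: "of_int r = x * of_int s" "of_int r0 = x0 * of_int s0" using ne rs(1) rs0(1) by simp_all
        have D: "of_int D = (x - x0)\<^sup>2 * (of_int s)\<^sup>2 * (of_int s0)\<^sup>2"
          unfolding D_def by (simp add: r algebra_simps power2_eq_square)
        have "of_int N = (x\<^sup>2 * x0 + x * x0\<^sup>2 + 2 * (p' + q') * x * x0 + p' * q' * (x + x0) - 2 * y * y0)
            * (of_int s)\<^sup>2 * (of_int s0)\<^sup>2"
          unfolding N_def A_def B_def of_int_diff of_int_mult Y(1)[symmetric] Y0[symmetric]
          by (simp add: r algebra_simps power2_eq_square)
        also have "\<dots> = of_int D * x3"
          unfolding D add_x[OF PK[unfolded P Affine] c c0, symmetric] by (simp add: mult_ac)
        finally have N: "of_int N = of_int D * x3" .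
        have "(of_int D :: rat) \<noteq> 0" unfolding D using False ne by simp
        then have D0: "D \<noteq> 0" and x3: "x3 = of_int N / of_int D" using N by auto
        have "\<bar>r\<bar>\<^sup>2 \<le> H\<^sup>2" "s\<^sup>2 \<le> H\<^sup>2" "\<bar>r\<bar> * s \<le> H * H"
          using power_mono[OF H(1), of 2] power_mono[OF H(2), of 2] mult_mono[OF H(1,2)] H(3) rs(3)
          by simp_all
        then have rs2: "r\<^sup>2 \<le> H\<^sup>2" "s\<^sup>2 \<le> H\<^sup>2" "\<bar>r * s\<bar> \<le> H\<^sup>2"
          using rs(3) by (simp_all add: abs_mult power2_eq_square)
        \<comment> \<open>Y^2 is a product of four factors, each at most a constant times
          \<open>H\<close>.\<close>
        have Y_le: "\<bar>Y\<bar> \<le> (1 + int p) * (1 + int q) * H\<^sup>2"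
        proof (rule power2_le_imp_le)
          have "\<bar>r + int p * s\<bar> \<le> \<bar>r\<bar> + int p * s" using rs(3) by (simp add: abs_mult order_trans[OF abs_triangle_ineq])
          also have "\<dots> \<le> H + int p * H" using H by (intro add_mono mult_left_mono) auto
          finally have 1: "\<bar>r + int p * s\<bar> \<le> (1 + int p) * H" by (simp add: algebra_simps)
          have "\<bar>r + int q * s\<bar> \<le> \<bar>r\<bar> + int q * s" using rs(3) by (simp add: abs_mult order_trans[OF abs_triangle_ineq])
          also have "\<dots> \<le> H + int q * H" using H by (intro add_mono mult_left_mono) auto
          finally have 2: "\<bar>r + int q * s\<bar> \<le> (1 + int q) * H" by (simp add: algebra_simps)
          have "\<bar>Y\<bar>\<^sup>2 = \<bar>Y\<^sup>2\<bar>" by simp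
          also have "\<dots> = \<bar>r\<bar> * \<bar>r + int p * s\<bar> * \<bar>r + int q * s\<bar> * s"
            unfolding Y(2) using rs(3) by (simp add: abs_mult)
          also have "\<dots> \<le> H * ((1 + int p) * H) * ((1 + int q) * H) * H"
            using 1 2 H rs(3) by (intro mult_mono) auto
          also have "\<dots> = ((1 + int p) * (1 + int q)) * (H\<^sup>2)\<^sup>2" by (simp add: power2_eq_square mult_ac)
          also have "\<dots> \<le> ((1 + int p) * (1 + int q))\<^sup>2 * (H\<^sup>2)\<^sup>2"
          proof (rule mult_right_mono)
            have "1 \<le> (1 + int p) * (1 + int q)" using mult_mono[of 1 "1 + int p" 1 "1 + int q"] by simp
            then show "(1 + int p) * (1 + int q) \<le> ((1 + int p) * (1 + int q))\<^sup>2"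
              using self_le_power[of "(1 + int p) * (1 + int q)" 2] by simp
          qed simp
          finally show "\<bar>Y\<bar>\<^sup>2 \<le> ((1 + int p) * (1 + int q) * H\<^sup>2)\<^sup>2" by (simp add: power_mult_distrib)
        qed simp
        have tri: "\<bar>u1 + u2 + u3 + u4 + u5 - u6\<bar> \<le> \<bar>u1\<bar> + \<bar>u2\<bar> + \<bar>u3\<bar> + \<bar>u4\<bar> + \<bar>u5\<bar> + \<bar>u6\<bar>"
          for u1 u2 u3 u4 u5 u6 :: int by linarith
        have "\<bar>N\<bar> \<le> \<bar>r\<^sup>2 * (r0 * s0)\<bar> + \<bar>r * s * r0\<^sup>2\<bar> + \<bar>2 * A * (r * s) * (r0 * s0)\<bar> + \<bar>B * (r * s) * s0\<^sup>2\<bar>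
          + \<bar>B * (r0 * s0) * s\<^sup>2\<bar> + \<bar>2 * Y * Y0\<bar>" unfolding N_def by (rule tri)
        also have "\<dots> = r\<^sup>2 * \<bar>r0 * s0\<bar> + \<bar>r * s\<bar> * r0\<^sup>2 + \<bar>r * s\<bar> * (2 * A * \<bar>r0 * s0\<bar>) + \<bar>r * s\<bar> * (B * s0\<^sup>2)
          + s\<^sup>2 * (B * \<bar>r0 * s0\<bar>) + \<bar>Y\<bar> * (2 * \<bar>Y0\<bar>)"
          using AB by (simp add: abs_mult mult_ac)
        also have "\<dots> \<le> H\<^sup>2 * \<bar>r0 * s0\<bar> + H\<^sup>2 * r0\<^sup>2 + H\<^sup>2 * (2 * A * \<bar>r0 * s0\<bar>) + H\<^sup>2 * (B * s0\<^sup>2)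
          + H\<^sup>2 * (B * \<bar>r0 * s0\<bar>) + (1 + int p) * (1 + int q) * H\<^sup>2 * (2 * \<bar>Y0\<bar>)"
          using rs2 AB Y_le by (intro add_mono mult_right_mono) auto
        also have "\<dots> = C1 * H\<^sup>2" by (simp add: C1_def algebra_simps)
        also have "\<dots> \<le> C * H\<^sup>2" using nonneg by (intro mult_right_mono) (auto simp: C_def)
        finally have N_le: "\<bar>N\<bar> \<le> C * H\<^sup>2" .
        have "\<bar>r * s0 - r0 * s\<bar> \<le> \<bar>r\<bar> * s0 + \<bar>r0\<bar> * s"
          using rs(3) rs0(2) abs_triangle_ineq4[of "r * s0" "r0 * s"] by (simp add: abs_mult)
        also have "\<dots> \<le> H * s0 + \<bar>r0\<bar> * H" using H rs(3) rs0(2) by (intro add_mono mult_mono) auto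
        also have "\<dots> = (s0 + \<bar>r0\<bar>) * H" by (simp add: algebra_simps)
        finally have "\<bar>r * s0 - r0 * s\<bar>\<^sup>2 \<le> ((s0 + \<bar>r0\<bar>) * H)\<^sup>2" by (intro power_mono) auto
        then have "\<bar>D\<bar> \<le> C2 * H\<^sup>2" by (simp add: D_def C2_def power_mult_distrib)
        also have "\<dots> \<le> C * H\<^sup>2" using nonneg by (intro mult_right_mono) (auto simp: C_def)
        finally have "height x3 \<le> C * H\<^sup>2"
          using N_le height_fraction_le[OF D0, of N] unfolding x3 by linarith
        then show ?thesis unfolding PK by (simp add: P H_def)
      qed
    qed
  qed
  then show ?thesis by blast
qed

end

section \<open>The rank\<close>

context twin_primes_point begin

lemma finite_translates: "finite translates"
  by (simp add: translates_def two_torsion_def)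

lemma translates_half_multiples: "translates \<subseteq> half_multiples"
  unfolding translates_def
  using two_torsion_half_multiples gen_half_multiple subgroup.m_closed[OF subgroup_half_multiples] by blast

text \<open>With P + K = 2R, the two height estimates combine to h(R)^4 <= D h(2R) <= D F h(P)^2,
  where \<open>F\<close> dominates the constants of all translates; then take square roots.\<close>

lemma descent_step_height:
  "\<exists>C\<ge>1. \<forall>P\<in>ec_points cubic. \<exists>R\<in>ec_points cubic. (\<exists>m\<in>half_multiples. P = m \<otimes>\<^bsub>E\<^esub> (R \<otimes>\<^bsub>E\<^esub> R)) \<and>
    (point_height R)\<^sup>2 \<le> C * point_height P"
proof -
  have "translates \<subseteq> ec_points cubic"
    using translates_half_multiples by (auto simp: half_multiples_def)
  then have "\<forall>K\<in>translates. \<exists>C. \<forall>P\<in>ec_points cubic. point_height (P \<otimes>\<^bsub>E\<^esub> K) \<le> C * (point_height P)\<^sup>2"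
    using height_add by blast
  then obtain f where f: "\<forall>K\<in>translates. \<forall>P\<in>ec_points cubic. point_height (P \<otimes>\<^bsub>E\<^esub> K) \<le> f K * (point_height P)\<^sup>2"
    by (auto dest!: bchoice)
  define F where "F = (\<Sum>K\<in>translates. \<bar>f K\<bar>)"
  obtain D where D: "\<forall>R\<in>ec_points cubic. point_height R ^ 4 \<le> D * point_height (R \<otimes>\<^bsub>E\<^esub> R)"
    using height_double by blast
  \<comment> \<open>Adding 1 gives C >= 1, which is used for C <= C^2 and for the alternative R =
    \<open>Infinity\<close>.\<close>
  define C where "C = \<bar>D\<bar> * F + 1"
  have F0: "F \<ge> 0" by (simp add: F_def sum_nonneg)
  have C1: "C \<ge> 1" using F0 by (simp add: C_def)
  have "\<exists>R\<in>ec_points cubic. (\<exists>m\<in>half_multiples. P = m \<otimes>\<^bsub>E\<^esub> (R \<otimes>\<^bsub>E\<^esub> R)) \<and> (point_height R)\<^sup>2 \<le> C * point_height P"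
    if P: "P \<in> ec_points cubic" for P
    using descent_step[OF P]
  proof
    assume "P \<in> half_multiples"
    moreover have "1 * 1 \<le> C * point_height P"
      using C1 point_height_pos[of P] by (intro mult_mono) auto
    ultimately show ?thesis by (intro bexI[of _ Infinity]) (auto simp: mult_E)
  next
    assume "\<exists>K\<in>translates. \<exists>R\<in>ec_points cubic. P \<otimes>\<^bsub>E\<^esub> K = R \<otimes>\<^bsub>E\<^esub> R"
    then obtain K R where K: "K \<in> translates" and R: "R \<in> ec_points cubic"
      and eq: "P \<otimes>\<^bsub>E\<^esub> K = R \<otimes>\<^bsub>E\<^esub> R" by blast
    have Kc: "K \<in> carrier E" using K \<open>translates \<subseteq> ec_points cubic\<close> by auto
    have Pc: "P \<in> carrier E" using P by simp
    have "inv\<^bsub>E\<^esub> K \<otimes>\<^bsub>E\<^esub> (P \<otimes>\<^bsub>E\<^esub> K) = (P \<otimes>\<^bsub>E\<^esub> K) \<otimes>\<^bsub>E\<^esub> inv\<^bsub>E\<^esub> K"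
      using Pc Kc by (intro E.m_comm E.m_closed E.inv_closed)
    also have "\<dots> = P" using Pc Kc by (simp add: E.m_assoc del: carrier_E one_E)
    finally have "P = inv\<^bsub>E\<^esub> K \<otimes>\<^bsub>E\<^esub> (R \<otimes>\<^bsub>E\<^esub> R)" using eq by simp
    moreover have "inv\<^bsub>E\<^esub> K \<in> half_multiples"
      using K translates_half_multiples subgroup.m_inv_closed[OF subgroup_half_multiples] by blast
    moreover have "(point_height R)\<^sup>2 \<le> C * point_height P"
    proof (rule power2_le_imp_le)
      have fF: "f K \<le> F"
        using member_le_sum[OF K, of "\<lambda>K. \<bar>f K\<bar>"] finite_translates unfolding F_def by fastforce
      have "((point_height R)\<^sup>2)\<^sup>2 = point_height R ^ 4" by (simp flip: power_mult)
      also have "\<dots> \<le> D * point_height (R \<otimes>\<^bsub>E\<^esub> R)" using D R by blast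
      also have "\<dots> \<le> \<bar>D\<bar> * point_height (R \<otimes>\<^bsub>E\<^esub> R)"
        using point_height_pos[of "R \<otimes>\<^bsub>E\<^esub> R"] by (intro mult_right_mono) auto
      also have "point_height (R \<otimes>\<^bsub>E\<^esub> R) \<le> f K * (point_height P)\<^sup>2" using f K P eq by metis
      then have "\<bar>D\<bar> * point_height (R \<otimes>\<^bsub>E\<^esub> R) \<le> \<bar>D\<bar> * (F * (point_height P)\<^sup>2)"
        using fF by (intro mult_left_mono order_trans[OF _ mult_right_mono[OF fF]]) auto
      also have "\<dots> \<le> C * (point_height P)\<^sup>2" by (simp add: C_def algebra_simps)
      also have "\<dots> \<le> C\<^sup>2 * (point_height P)\<^sup>2"
        using self_le_power[OF C1, of 2] by (intro mult_right_mono) auto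
      finally show "((point_height R)\<^sup>2)\<^sup>2 \<le> (C * point_height P)\<^sup>2" by (simp add: power_mult_distrib)
      show "0 \<le> C * point_height P" using C1 point_height_pos[of P] by simp
    qed
    ultimately show ?thesis using R by blast
  qed
  then show ?thesis using C1 by blast
qed

text \<open>
  The orbit of \<open>P\<close> under the descent step \<open>P = m + 2 R \<mapsto> R\<close> has bounded height, hence it is
  eventually periodic, and a periodic point \<open>X\<close> satisfies \<open>X = m + 2\<^sup>k X\<close>.
\<close>
lemma multiple_in_half_multiples:
  assumes P: "P \<in> ec_points cubic"
  shows "\<exists>e::nat>0. P [^]\<^bsub>E\<^esub> e \<in> half_multiples"
proof -
  obtain C where C: "C \<ge> 1" "\<forall>P\<in>ec_points cubic. \<exists>R. R \<in> ec_points cubic \<and>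
      (\<exists>m\<in>half_multiples. P = m \<otimes>\<^bsub>E\<^esub> (R \<otimes>\<^bsub>E\<^esub> R)) \<and> (point_height R)\<^sup>2 \<le> C * point_height P"
    using descent_step_height by blast
  obtain g where g: "\<And>P. P \<in> ec_points cubic \<Longrightarrow> g P \<in> ec_points cubic"
    "\<And>P. P \<in> ec_points cubic \<Longrightarrow> \<exists>m\<in>half_multiples. P = m \<otimes>\<^bsub>E\<^esub> (g P \<otimes>\<^bsub>E\<^esub> g P)"
    "\<And>P. P \<in> ec_points cubic \<Longrightarrow> (point_height (g P))\<^sup>2 \<le> C * point_height P"
    using bchoice[OF C(2)] by blast
  define X where "X i = (g ^^ i) P" for i
  \<comment> \<open>This bound is inherited by the next point: its squared height is at most C N,
    hence at most N^2.\<close>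
  define N where "N = max C (point_height P)"
  have X: "X i \<in> carrier E" for i unfolding X_def by (induction i) (use P g(1) in auto)
  have XN: "point_height (X i) \<le> N" for i
  proof (induction i)
    case (Suc i)
    have "(point_height (X (Suc i)))\<^sup>2 \<le> C * point_height (X i)"
      using g(3)[of "X i"] X[of i] by (simp add: X_def)
    also have "\<dots> \<le> N * N"
      using Suc C(1) point_height_pos[of "X i"] by (intro mult_mono) (auto simp: N_def)
    finally have "(point_height (X (Suc i)))\<^sup>2 \<le> N\<^sup>2" by (simp add: power2_eq_square)
    then show ?case by (rule power2_le_imp_le) (use C(1) in \<open>simp add: N_def\<close>)
  qed (simp add: X_def N_def)
  have "range X \<subseteq> {P \<in> ec_points cubic. point_height P \<le> N}" using X XN by auto
  then have "finite (range X)" using finite_point_height_le finite_subset by blast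
  then have "\<not> inj X" using finite_imageD infinite_UNIV_nat by blast
  then obtain i j where ij: "X i = X j" "i < j" by (metis injI linorder_neqE_nat)
  have M: "half_multiples \<subseteq> carrier E" by (auto simp: half_multiples_def)
  have Mpow: "m [^]\<^bsub>E\<^esub> (n::nat) \<in> half_multiples" if "m \<in> half_multiples" for m n
    using that subgroup.m_closed[OF subgroup_half_multiples] subgroup.one_closed[OF subgroup_half_multiples]
    by (induction n) auto
  have step: "\<exists>m\<in>half_multiples. X i = m \<otimes>\<^bsub>E\<^esub> X (i + k) [^]\<^bsub>E\<^esub> (2 ^ k :: nat)" for i k
  proof (induction k)
    case 0
    show ?case using X[of i] subgroup.one_closed[OF subgroup_half_multiples]
      by (intro bexI[of _ "\<one>\<^bsub>E\<^esub>"]) (simp_all del: carrier_E one_E)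
  next
    case (Suc k)
    define n where "n = (2 ^ k :: nat)"
    define B where "B = X (i + Suc k)"
    have B: "B \<in> carrier E" unfolding B_def by (rule X)
    obtain m where m: "m \<in> half_multiples" "X i = m \<otimes>\<^bsub>E\<^esub> X (i + k) [^]\<^bsub>E\<^esub> n"
      using Suc unfolding n_def by blast
    obtain m' where m': "m' \<in> half_multiples" "X (i + k) = m' \<otimes>\<^bsub>E\<^esub> (B \<otimes>\<^bsub>E\<^esub> B)"
      using g(2)[of "X (i + k)"] X[of "i + k"] by (auto simp: X_def B_def)
    have c: "m \<in> carrier E" "m' \<in> carrier E" using m m' M by auto
    have "X i = m \<otimes>\<^bsub>E\<^esub> (m' [^]\<^bsub>E\<^esub> n \<otimes>\<^bsub>E\<^esub> (B [^]\<^bsub>E\<^esub> n \<otimes>\<^bsub>E\<^esub> B [^]\<^bsub>E\<^esub> n))"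
      unfolding m(2) m'(2) using B c by (simp add: E.nat_pow_distrib del: carrier_E)
    also have "\<dots> = (m \<otimes>\<^bsub>E\<^esub> m' [^]\<^bsub>E\<^esub> n) \<otimes>\<^bsub>E\<^esub> B [^]\<^bsub>E\<^esub> (n + n)"
      using B c by (simp add: E.m_assoc E.nat_pow_mult del: carrier_E)
    finally have "X i = (m \<otimes>\<^bsub>E\<^esub> m' [^]\<^bsub>E\<^esub> n) \<otimes>\<^bsub>E\<^esub> X (i + Suc k) [^]\<^bsub>E\<^esub> (2 ^ Suc k :: nat)"
      by (simp add: n_def B_def mult_2)
    moreover have "m \<otimes>\<^bsub>E\<^esub> m' [^]\<^bsub>E\<^esub> n \<in> half_multiples"
      using m m' Mpow subgroup.m_closed[OF subgroup_half_multiples] by blast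
    ultimately show ?case by blast
  qed
  \<comment> \<open>With X i = X j, the relation X = m + 2^(j-i) X becomes e X = -m, and i < j makes
    \<open>e\<close> positive.\<close>
  define e where "e = (2 ^ (j - i) - 1 :: nat)"
  have "(2 ^ (j - i) :: nat) > 1" using ij(2) by (intro one_less_power) auto
  then have e: "e > 0" "2 ^ (j - i) = Suc e" by (auto simp: e_def)
  obtain m where m: "m \<in> half_multiples" "X i = m \<otimes>\<^bsub>E\<^esub> X i [^]\<^bsub>E\<^esub> (Suc e)"
    using step[of i "j - i"] ij e(2) by auto
  have mc: "m \<in> carrier E" using m M by auto
  have "(m \<otimes>\<^bsub>E\<^esub> X i [^]\<^bsub>E\<^esub> e) \<otimes>\<^bsub>E\<^esub> X i = \<one>\<^bsub>E\<^esub> \<otimes>\<^bsub>E\<^esub> X i"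
    using m(2) X[of i] mc by (simp add: E.m_assoc del: carrier_E one_E)
  then have "m \<otimes>\<^bsub>E\<^esub> X i [^]\<^bsub>E\<^esub> e = \<one>\<^bsub>E\<^esub>"
    using X[of i] mc by (metis E.m_closed E.nat_pow_closed E.one_closed E.right_cancel)
  then have "X i [^]\<^bsub>E\<^esub> e = inv\<^bsub>E\<^esub> m"
    using X[of i] mc by (metis E.inv_equality E.m_comm E.nat_pow_closed)
  then have Xe: "X i [^]\<^bsub>E\<^esub> e \<in> half_multiples"
    using m(1) subgroup.m_inv_closed[OF subgroup_half_multiples] by simp
  obtain m0 where m0: "m0 \<in> half_multiples" "P = m0 \<otimes>\<^bsub>E\<^esub> X i [^]\<^bsub>E\<^esub> (2 ^ i :: nat)"
    using step[of 0 i] by (auto simp: X_def)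
  have m0c: "m0 \<in> carrier E" using m0(1) M by auto
  have "P [^]\<^bsub>E\<^esub> e = m0 [^]\<^bsub>E\<^esub> e \<otimes>\<^bsub>E\<^esub> (X i [^]\<^bsub>E\<^esub> (2 ^ i :: nat)) [^]\<^bsub>E\<^esub> e"
    unfolding m0(2) using m0c X[of i] by (intro E.nat_pow_distrib E.nat_pow_closed)
  also have "(X i [^]\<^bsub>E\<^esub> (2 ^ i :: nat)) [^]\<^bsub>E\<^esub> e = (X i [^]\<^bsub>E\<^esub> e) [^]\<^bsub>E\<^esub> (2 ^ i :: nat)"
    using X[of i] by (simp add: E.nat_pow_pow mult.commute del: carrier_E)
  finally have "P [^]\<^bsub>E\<^esub> e = m0 [^]\<^bsub>E\<^esub> e \<otimes>\<^bsub>E\<^esub> (X i [^]\<^bsub>E\<^esub> e) [^]\<^bsub>E\<^esub> (2 ^ i :: nat)" .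
  then have "P [^]\<^bsub>E\<^esub> e \<in> half_multiples"
    using Mpow m0(1) Xe subgroup.m_closed[OF subgroup_half_multiples] by simp
  then show ?thesis using e(1) by blast
qed

lemma multiple_is_multiple_of_gen:
  assumes P: "P \<in> ec_points cubic"
  shows "\<exists>(d::int) (n::int). d > 0 \<and> P [^]\<^bsub>E\<^esub> d = gen [^]\<^bsub>E\<^esub> n"
proof -
  obtain e n where e: "e > 0" "P [^]\<^bsub>E\<^esub> (e::nat) \<otimes>\<^bsub>E\<^esub> P [^]\<^bsub>E\<^esub> e = gen [^]\<^bsub>E\<^esub> (n::int)"
    using multiple_in_half_multiples[OF P] by (auto simp: half_multiples_def)
  have "P [^]\<^bsub>E\<^esub> int (e + e) = gen [^]\<^bsub>E\<^esub> n"
    using e(2) P unfolding int_pow_int by (simp add: E.nat_pow_mult)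
  moreover have "int (e + e) > 0" using e(1) by simp
  ultimately show ?thesis by blast
qed

end

lemma (in comm_group) int_independent_pair:
  assumes S: "finite S" "S \<subseteq> carrier G" "int_independent G S"
    and PQ: "P \<in> S" "Q \<in> S" "P \<noteq> Q" and rel: "P [^] (k::int) \<otimes> Q [^] (l::int) = \<one>"
  shows "k = 0" "l = 0"
proof -
  define n where "n = (\<lambda>x. if x = P then k else if x = Q then l else 0)"
  define S' where "S' = S - {P, Q}"
  have S': "S = insert P (insert Q S')" "P \<notin> insert Q S'" "Q \<notin> S'" "finite S'" "S' \<subseteq> carrier G"
    using S PQ by (auto simp: S'_def)
  have c: "P \<in> carrier G" "Q \<in> carrier G" using S PQ by auto
  have "finprod G (\<lambda>x. x [^] n x) S' = \<one>"
    by (rule finprod_one_eqI) (auto simp: n_def S'_def)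
  then have "finprod G (\<lambda>x. x [^] n x) S = P [^] n P \<otimes> (Q [^] n Q \<otimes> \<one>)"
    using S' c by (simp add: Pi_def subset_iff)
  also have "\<dots> = \<one>" using rel c PQ(3) by (simp add: n_def)
  finally have "\<forall>x\<in>S. n x = 0" using S(3) unfolding int_independent_def by blast
  then show "k = 0" "l = 0" using PQ by (auto simp: n_def split: if_splits)
qed

theorem (in twin_primes_point) rank_eq_1: "abelian_rank E = 1"
  unfolding abelian_rank_def
proof (rule antisym)
  show "(SUP S\<in>{S. S \<subseteq> carrier E \<and> finite S \<and> int_independent E S}. enat (card S)) \<le> 1"
  proof (rule SUP_least)
    fix S assume "S \<in> {S. S \<subseteq> carrier E \<and> finite S \<and> int_independent E S}"
    then have S: "finite S" "S \<subseteq> carrier E" "int_independent E S" by auto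
    have "P = Q" if PQ: "P \<in> S" "Q \<in> S" for P Q
    proof (rule ccontr)
      assume ne: "P \<noteq> Q"
      have c: "P \<in> carrier E" "Q \<in> carrier E" "gen \<in> carrier E" using S PQ by auto
      obtain d n d' n' :: int where d: "d > 0" "P [^]\<^bsub>E\<^esub> d = gen [^]\<^bsub>E\<^esub> n"
        and d': "d' > 0" "Q [^]\<^bsub>E\<^esub> d' = gen [^]\<^bsub>E\<^esub> n'"
        using multiple_is_multiple_of_gen c by (metis carrier_E)
      \<comment> \<open>Eliminating \<open>gen\<close> gives a relation between P and Q.
        Independence and d' > 0 force n = 0, so P would be a torsion point, which contradicts
        independence again.\<close>
      have "P [^]\<^bsub>E\<^esub> (d * n') \<otimes>\<^bsub>E\<^esub> Q [^]\<^bsub>E\<^esub> (d' * - n) = gen [^]\<^bsub>E\<^esub> (n * n') \<otimes>\<^bsub>E\<^esub> gen [^]\<^bsub>E\<^esub> (n' * - n)"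
        using c d(2) d'(2) by (metis E.int_pow_pow)
      also have "\<dots> = gen [^]\<^bsub>E\<^esub> (n * n' + n' * - n)" using c(3) by (rule E.int_pow_mult[symmetric])
      also have "\<dots> = \<one>\<^bsub>E\<^esub>" by (simp add: mult.commute del: one_E)
      finally have "d' * - n = 0" by (rule E.int_independent_pair(2)[OF S PQ ne])
      then have "P [^]\<^bsub>E\<^esub> d \<otimes>\<^bsub>E\<^esub> Q [^]\<^bsub>E\<^esub> (0::int) = \<one>\<^bsub>E\<^esub>"
        using d d'(1) by (simp del: one_E carrier_E)
      then have "d = 0" by (rule E.int_independent_pair(1)[OF S PQ ne])
      then show False using d(1) by simp
    qed
    then have "card S \<le> Suc 0" using S(1) by (simp add: card_le_Suc0_iff_eq)
    then show "enat (card S) \<le> 1" by (simp add: one_enat_def)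
  qed
  have "int_independent E {gen}"
    unfolding int_independent_def
  proof (intro allI impI)
    fix n :: "rat point \<Rightarrow> int"
    assume "finprod E (\<lambda>x. x [^]\<^bsub>E\<^esub> n x) {gen} = \<one>\<^bsub>E\<^esub>"
    moreover have "gen \<in> carrier E" by simp
    ultimately have "gen [^]\<^bsub>E\<^esub> n gen = \<one>\<^bsub>E\<^esub>"
      by (simp add: Pi_def del: one_E carrier_E)
    then show "\<forall>x\<in>{gen}. n x = 0" using gen_int_pow_eq_one by simp
  qed
  then show "1 \<le> (SUP S\<in>{S. S \<subseteq> carrier E \<and> finite S \<and> int_independent E S}. enat (card S))"
    by (intro SUP_upper2[of "{gen}"]) (auto simp: one_enat_def)
qed

theorem theorem5:
  fixes p q :: nat and a b c \<epsilon> \<delta> :: int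
  assumes "prime p" and "prime q"
    and "q = p + 2" and "p mod 8 = 3"
    and "\<epsilon> \<in> {1, -1}" and "\<delta> \<in> {1, -1}"
    and "int q = a\<^sup>2 + b\<^sup>2"
    and "(a + \<epsilon>)\<^sup>2 + (b + \<delta>)\<^sup>2 = c\<^sup>2"
  shows "abelian_rank (ec_group ([:0, 1:] * [:of_nat p, 1:] * [:of_nat q, 1:] :: rat poly)) = 1"
proof -
  have "(\<epsilon> * a + 1)\<^sup>2 + (\<delta> * b + 1)\<^sup>2 = c\<^sup>2" "int q = (\<epsilon> * a)\<^sup>2 + (\<delta> * b)\<^sup>2"
    using assms(5-8) by (auto simp: power2_eq_square algebra_simps)
  then interpret twin_primes_point p q "\<epsilon> * a" "\<delta> * b" c
    using assms(1-4) by unfold_locales blast+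
  show ?thesis using rank_eq_1 unfolding cubic_eq .
qed

end
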